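(* Let $G$ be a topological group and let $\alpha\colon \mathbb{R} \to \operatorname{Aut}(G)$, $t \mapsto \alpha_t$, be a homomorphism defining a continuous action of $\mathbb{R}$ on $G$. Let $G^\sharp := G \rtimes_\alpha \mathbb{R}$ be the corresponding semidirect product topological group. If $(\pi^\sharp, \mathcal{H})$ is an irreducible positive energy representation of $G^\sharp$, then its restriction $\pi := \pi^\sharp|_G$ to $G$ is also irreducible.
   Context: $\mathcal{H}$ denotes a complex Hilbert space. A continuous action means that the map $\mathbb{R} \times G \to G$, $(t,g) \mapsto \alpha_t(g)$, is continuous. A positive energy representation of $G^\sharp = G\rtimes_\alpha\mathbb{R}$ is a continuous unitary representation $(\pi^\sharp,\mathcal{H})$ (continuous with respect to the strong operator topology on the unitary group) such that the infinitesimal generator $A = -i\frac{d}{dt}\big|_{t=0} U_t$ of the unitary one-parameter group $U_t := \pi^\sharp(\mathbf{1},t)$ (so $U_t = e^{itA}$) has non-negative spectrum. $G$ is identified with the subgroup $G\times\{0\}$ of $G^\sharp$. *)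

theory Defs
  imports "HOL-Analysis.Analysis" "HOL-Algebra.Bij"
begin

section \<open>Complex Hilbert spaces\<close>

text \<open>
  The real part of the Hermitian form is required to be the real inner product of the class
  \<open>real_inner\<close>; positive definiteness of \<open>cinner\<close> and \<open>norm x = sqrt (Re (cinner x x))\<close>
  are therefore inherited. The form is antilinear in its first argument.
\<close>

class complex_inner = real_inner +
  fixes scaleC :: "complex \<Rightarrow> 'a \<Rightarrow> 'a"  (infixr \<open>*\<^sub>C\<close> 75)
    and cinner :: "'a \<Rightarrow> 'a \<Rightarrow> complex"
  assumes scaleC_add_right: "a *\<^sub>C (x + y) = a *\<^sub>C x + a *\<^sub>C y"
    and scaleC_add_left: "(a + b) *\<^sub>C x = a *\<^sub>C x + b *\<^sub>C x"
    and scaleC_scaleC: "a *\<^sub>C (b *\<^sub>C x) = (a * b) *\<^sub>C x"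
    and scaleC_one: "1 *\<^sub>C x = x"
    and scaleR_scaleC: "r *\<^sub>R x = complex_of_real r *\<^sub>C x"
    and cinner_commute: "cinner x y = cnj (cinner y x)"
    and cinner_add_left: "cinner (x + y) z = cinner x z + cinner y z"
    and cinner_scaleC_left: "cinner (a *\<^sub>C x) y = cnj a * cinner x y"
    and inner_eq_Re_cinner: "inner x y = Re (cinner x y)"

class chilbert_space = complex_inner + complete_space

global_interpretation complex_vector: vector_space "scaleC :: complex \<Rightarrow> 'a \<Rightarrow> 'a::complex_inner"
  by unfold_locales
    (simp_all add: scaleC_add_right scaleC_add_left scaleC_scaleC scaleC_one)

instantiation complex :: chilbert_space
begin

definition scaleC_complex :: "complex \<Rightarrow> complex \<Rightarrow> complex"
  where "scaleC_complex a x = a * x"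

definition cinner_complex :: "complex \<Rightarrow> complex \<Rightarrow> complex"
  where "cinner_complex x y = cnj x * y"

instance
  by standard
    (simp_all add: scaleC_complex_def cinner_complex_def algebra_simps scaleR_conv_of_real
      inner_complex_def)

end


section \<open>Topological groups and semidirect products with the real line\<close>

locale topological_group = group G for G :: "('g, 'm) monoid_scheme" (structure) +
  fixes T :: "'g topology"
  assumes topspace_eq_carrier: "topspace T = carrier G"
    and continuous_mult: "continuous_map (prod_topology T T) T (\<lambda>(x, y). x \<otimes> y)"
    and continuous_inv: "continuous_map T T (\<lambda>x. inv x)"

definition real_additive_group :: "real monoid"
  where "real_additive_group = \<lparr>carrier = UNIV, monoid.mult = (+), one = 0\<rparr>"

definition continuous_real_action ::
    "('g, 'm) monoid_scheme \<Rightarrow> 'g topology \<Rightarrow> (real \<Rightarrow> 'g \<Rightarrow> 'g) \<Rightarrow> bool"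
  where "continuous_real_action G T \<alpha> \<longleftrightarrow>
    \<alpha> \<in> hom real_additive_group (AutoGroup G) \<and>
    continuous_map (prod_topology euclideanreal T) T (\<lambda>(t, g). \<alpha> t g)"

definition semidirect_real ::
    "('g, 'm) monoid_scheme \<Rightarrow> (real \<Rightarrow> 'g \<Rightarrow> 'g) \<Rightarrow> ('g \<times> real) monoid"
  where "semidirect_real G \<alpha> =
    \<lparr>carrier = carrier G \<times> UNIV,
     monoid.mult = (\<lambda>(g, s) (h, t). (g \<otimes>\<^bsub>G\<^esub> \<alpha> s h, s + t)),
     one = (\<one>\<^bsub>G\<^esub>, 0)\<rparr>"

abbreviation semidirect_real_topology :: "'g topology \<Rightarrow> ('g \<times> real) topology"
  where "semidirect_real_topology T \<equiv> prod_topology T euclideanreal"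

lemma continuous_real_action_simps:
  assumes G: "group G" and act: "continuous_real_action G T \<alpha>"
  shows "g \<in> carrier G \<Longrightarrow> \<alpha> t g \<in> carrier G"
    and "g \<in> carrier G \<Longrightarrow> h \<in> carrier G \<Longrightarrow> \<alpha> t (g \<otimes>\<^bsub>G\<^esub> h) = \<alpha> t g \<otimes>\<^bsub>G\<^esub> \<alpha> t h"
    and "g \<in> carrier G \<Longrightarrow> \<alpha> (s + t) g = \<alpha> s (\<alpha> t g)"
    and "g \<in> carrier G \<Longrightarrow> \<alpha> 0 g = g"
    and "\<alpha> t \<one>\<^bsub>G\<^esub> = \<one>\<^bsub>G\<^esub>"
proof -
  interpret group G by (rule G)
  have hom: "\<alpha> \<in> hom real_additive_group (AutoGroup G)"
    using act by (simp add: continuous_real_action_def)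
  have aut: "\<alpha> t \<in> auto G" for t
    using hom_in_carrier[OF hom, of t] by (simp add: real_additive_group_def AutoGroup_def)
  have bij: "\<alpha> t \<in> Bij (carrier G)" and homG: "\<alpha> t \<in> hom G G" for t
    using aut[of t] by (auto simp: auto_def)
  show closed: "\<alpha> t g \<in> carrier G" if "g \<in> carrier G" for t g
    using homG[of t] that by (rule hom_in_carrier)
  show "\<alpha> t (g \<otimes>\<^bsub>G\<^esub> h) = \<alpha> t g \<otimes>\<^bsub>G\<^esub> \<alpha> t h" if "g \<in> carrier G" "h \<in> carrier G"
    using homG[of t] that by (rule hom_mult)
  show add: "\<alpha> (s + t) g = \<alpha> s (\<alpha> t g)" if "g \<in> carrier G" for s t g
    using hom_mult[OF hom, of s t] bij that
    by (simp add: real_additive_group_def AutoGroup_def BijGroup_def compose_def)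
  show "\<alpha> 0 g = g" if g: "g \<in> carrier G"
  proof -
    have "inj_on (\<alpha> 0) (carrier G)"
      using bij[of 0] by (simp add: Bij_def bij_betw_def)
    moreover have "\<alpha> 0 (\<alpha> 0 g) = \<alpha> 0 g"
      using add[OF g, of 0 0] by simp
    ultimately show ?thesis
      using closed[OF g] g by (meson inj_onD)
  qed
  show "\<alpha> t \<one>\<^bsub>G\<^esub> = \<one>\<^bsub>G\<^esub>"
    using hom_one[OF homG[of t] G G] .
qed

lemma group_semidirect_real:
  assumes G: "group G" and act: "continuous_real_action G T \<alpha>"
  shows "group (semidirect_real G \<alpha>)"
    and "g \<in> carrier G \<Longrightarrow> inv\<^bsub>semidirect_real G \<alpha>\<^esub> (g, t) = (\<alpha> (- t) (inv\<^bsub>G\<^esub> g), - t)"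
proof -
  interpret group G by (rule G)
  note [simp] = continuous_real_action_simps[OF G act]
  have linv: "\<alpha> (- t) (inv\<^bsub>G\<^esub> g) \<otimes>\<^bsub>G\<^esub> \<alpha> (- t) g = \<one>\<^bsub>G\<^esub>" if "g \<in> carrier G" for t g
    using that continuous_real_action_simps(2)[OF G act, of "inv\<^bsub>G\<^esub> g" g "- t"] by simp
  show grp: "group (semidirect_real G \<alpha>)"
  proof (rule groupI)
    fix x assume "x \<in> carrier (semidirect_real G \<alpha>)"
    then obtain g t where "x = (g, t)" "g \<in> carrier G"
      by (auto simp: semidirect_real_def)
    then show "\<exists>y\<in>carrier (semidirect_real G \<alpha>).
        y \<otimes>\<^bsub>semidirect_real G \<alpha>\<^esub> x = \<one>\<^bsub>semidirect_real G \<alpha>\<^esub>"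
      by (intro bexI[of _ "(\<alpha> (- t) (inv\<^bsub>G\<^esub> g), - t)"]) (auto simp: semidirect_real_def linv)
  qed (auto simp: semidirect_real_def m_assoc)
  show "inv\<^bsub>semidirect_real G \<alpha>\<^esub> (g, t) = (\<alpha> (- t) (inv\<^bsub>G\<^esub> g), - t)" if "g \<in> carrier G"
    by (rule group.inv_equality[OF grp]) (use that in \<open>auto simp: semidirect_real_def linv\<close>)
qed

lemma topological_group_semidirect_real:
  assumes "topological_group G T" and act: "continuous_real_action G T \<alpha>"
  shows "topological_group (semidirect_real G \<alpha>) (semidirect_real_topology T)"
proof -
  interpret topological_group G T by fact
  let ?S = "semidirect_real_topology T"
  have cact: "continuous_map X T (\<lambda>x. \<alpha> (f x) (h x))"
    if "continuous_map X euclideanreal f" "continuous_map X T h" for X :: "'z topology" and f h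
  proof -
    have "continuous_map (prod_topology euclideanreal T) T (\<lambda>(t, g). \<alpha> t g)"
      using act by (simp add: continuous_real_action_def)
    from continuous_map_compose[OF _ this, of X "\<lambda>x. (f x, h x)"] that show ?thesis
      by (simp add: continuous_map_paired o_def)
  qed
  have cmult: "continuous_map X T (\<lambda>x. f x \<otimes>\<^bsub>G\<^esub> h x)"
    if "continuous_map X T f" "continuous_map X T h" for X :: "'z topology" and f h
    using continuous_map_compose[OF _ continuous_mult, of X "\<lambda>x. (f x, h x)"] that
    by (simp add: continuous_map_paired o_def)
  have p1: "continuous_map (prod_topology ?S ?S) T (\<lambda>p. fst (fst p))"
    and p2: "continuous_map (prod_topology ?S ?S) euclideanreal (\<lambda>p. snd (fst p))"
    and p3: "continuous_map (prod_topology ?S ?S) T (\<lambda>p. fst (snd p))"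
    and p4: "continuous_map (prod_topology ?S ?S) euclideanreal (\<lambda>p. snd (snd p))"
    using continuous_map_compose[OF continuous_map_fst continuous_map_fst]
      continuous_map_compose[OF continuous_map_fst continuous_map_snd]
      continuous_map_compose[OF continuous_map_snd continuous_map_fst]
      continuous_map_compose[OF continuous_map_snd continuous_map_snd]
    by (auto simp: o_def)
  have "continuous_map (prod_topology ?S ?S) ?S
      (\<lambda>p. (fst (fst p) \<otimes>\<^bsub>G\<^esub> \<alpha> (snd (fst p)) (fst (snd p)), snd (fst p) + snd (snd p)))"
    unfolding continuous_map_paired
    by (intro conjI cmult cact p1 p2 p3 continuous_map_add p4)
  then have mult: "continuous_map (prod_topology ?S ?S) ?S
      (\<lambda>(x, y). x \<otimes>\<^bsub>semidirect_real G \<alpha>\<^esub> y)"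
    by (simp add: semidirect_real_def case_prod_beta')
  have "continuous_map ?S T (\<lambda>x. inv\<^bsub>G\<^esub> (fst x))"
    using continuous_map_compose[OF continuous_map_fst continuous_inv] by (simp add: o_def)
  then have "continuous_map ?S ?S (\<lambda>x. (\<alpha> (- snd x) (inv\<^bsub>G\<^esub> (fst x)), - snd x))"
    unfolding continuous_map_paired
    by (intro conjI cact continuous_map_minus continuous_map_snd)
  then have "continuous_map ?S ?S (\<lambda>x. inv\<^bsub>semidirect_real G \<alpha>\<^esub> x)"
    by (rule continuous_map_eq)
      (auto simp: topspace_eq_carrier group_semidirect_real(2)[OF is_group act])
  with mult show ?thesis
    by (intro topological_group.intro topological_group_axioms.intro
        group_semidirect_real(1)[OF is_group act])
      (auto simp: semidirect_real_def topspace_eq_carrier)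
qed


section \<open>Unitary representations\<close>

definition unitary_group :: "('h::chilbert_space \<Rightarrow>\<^sub>L 'h) monoid"
  where "unitary_group =
    \<lparr>carrier = {U. Vector_Spaces.linear scaleC scaleC (blinfun_apply U) \<and>
                   (\<forall>x y. cinner (blinfun_apply U x) (blinfun_apply U y) = cinner x y) \<and>
                   surj (blinfun_apply U)},
     monoid.mult = blinfun_compose,
     one = id_blinfun\<rparr>"

definition unitary_representation ::
    "('g, 'm) monoid_scheme \<Rightarrow> 'g topology \<Rightarrow> ('g \<Rightarrow> 'h::chilbert_space \<Rightarrow>\<^sub>L 'h) \<Rightarrow> bool"
  where "unitary_representation G T \<pi> \<longleftrightarrow>
    \<pi> \<in> hom G unitary_group \<and>
    continuous_map T (subtopology strong_operator_topology (carrier unitary_group)) \<pi>"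

definition irreducible_unitary_representation ::
    "('g, 'm) monoid_scheme \<Rightarrow> 'g topology \<Rightarrow> ('g \<Rightarrow> 'h::chilbert_space \<Rightarrow>\<^sub>L 'h) \<Rightarrow> bool"
  where "irreducible_unitary_representation G T \<pi> \<longleftrightarrow>
    unitary_representation G T \<pi> \<and>
    (UNIV :: 'h set) \<noteq> {0} \<and>
    (\<forall>W. closed W \<and> complex_vector.subspace W \<and> (\<forall>g\<in>carrier G. blinfun_apply (\<pi> g) ` W \<subseteq> W)
      \<longrightarrow> W = {0} \<or> W = UNIV)"


section \<open>Infinitesimal generators and spectrum\<close>

text \<open>
  An unbounded operator is represented by its domain \<open>D\<close> and a total function \<open>A\<close> whose
  values outside \<open>D\<close> are irrelevant.
\<close>

definition generator_domain :: "(real \<Rightarrow> 'h::chilbert_space \<Rightarrow>\<^sub>L 'h) \<Rightarrow> 'h set"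
  where "generator_domain U =
    {v. \<exists>w. ((\<lambda>t. blinfun_apply (U t) v) has_vector_derivative w) (at 0)}"

definition generator :: "(real \<Rightarrow> 'h::chilbert_space \<Rightarrow>\<^sub>L 'h) \<Rightarrow> 'h \<Rightarrow> 'h"
  where "generator U v = (- \<i>) *\<^sub>C vector_derivative (\<lambda>t. blinfun_apply (U t) v) (at 0)"

definition resolvent_set :: "'h::chilbert_space set \<Rightarrow> ('h \<Rightarrow> 'h) \<Rightarrow> complex set"
  where "resolvent_set D A =
    {z. bij_betw (\<lambda>v. A v - z *\<^sub>C v) D UNIV \<and>
        bounded_linear (inv_into D (\<lambda>v. A v - z *\<^sub>C v))}"

definition operator_spectrum :: "'h::chilbert_space set \<Rightarrow> ('h \<Rightarrow> 'h) \<Rightarrow> complex set"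
  where "operator_spectrum D A = - resolvent_set D A"

definition positive_energy_representation ::
    "('g, 'm) monoid_scheme \<Rightarrow> 'g topology \<Rightarrow> (real \<Rightarrow> 'g \<Rightarrow> 'g)
      \<Rightarrow> ('g \<times> real \<Rightarrow> 'h::chilbert_space \<Rightarrow>\<^sub>L 'h) \<Rightarrow> bool"
  where "positive_energy_representation G T \<alpha> \<pi> \<longleftrightarrow>
    unitary_representation (semidirect_real G \<alpha>) (semidirect_real_topology T) \<pi> \<and>
    (let U = (\<lambda>t. \<pi> (\<one>\<^bsub>G\<^esub>, t))
     in operator_spectrum (generator_domain U) (generator U) \<subseteq> \<real>\<^sub>\<ge>\<^sub>0)"

end

(* Let P be the orthogonal projection onto a closed G-invariant subspace. Its translates
   P_t = U_t P U_{-t} commute with G. For a function q that is holomorphic and decaying on the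
   upper half plane, the operator  int e^{i L t} q(t) P_{r-t} dt  raises the energy by at least L;
   the vectors orthogonal to all its values form a G^sharp-invariant subspace, which is 0 or everything.
   If it were 0 for some L > 0, then "energy >= m" would imply "energy >= m + L" for the whole
   representation, so starting from positive energy all energies would exceed every n L, which is
   impossible. Hence it is everything for all L > 0. As P is self-adjoint, every matrix coefficient of
   t |-> P_t is annihilated by the test functions of both half planes, so its Poisson integral is
   constant, P_t = P, and the subspace is invariant under G^sharp.

   "Energy >= m" is expressed without the spectral theorem: int e^{-i m t} g(t) <x, U_t y> dt = 0 for
   all test functions g of the upper half plane. For m = 0 this follows from the spectral condition by
   approximating U_t by the polynomials (1 + i t B / n)^n in bounded positive Yosida approximants B of
   the generator and by shifting the contour to a large half circle. *)

theory Submission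
  imports Defs "HOL-Complex_Analysis.Cauchy_Integral_Formula" "HOL-Probability.Sinc_Integral"
begin

section \<open>Complex Hilbert spaces\<close>

text \<open>Boundary values of functions holomorphic in the upper half plane annihilate every exp (i
  \<lambda> t) with \<lambda> \<ge> 0; they stand in for Fourier support in a half line. Because the
  class is stable under products with real translates, frequency bounds add up, and this is all that
  the raising argument needs. Operators are never integrated: only matrix coefficients are, and the
  Riesz theorem turns the resulting functional into a vector that irreducibility forces to vanish.
  The gap \<Lambda> has to be strictly positive for the iteration to exhaust all energies, so
  frequency 0 is reached only afterwards, by letting \<Lambda> tend to 0.

  The obstacle is the start m = 0. The spectral condition supplies bounded inverses of A + c for c >
  0, but no norm estimate. Self-adjointness of these inverses, available because A is symmetric,
  together with invertibility for all c > 0, forces the norm to be at most 1/c. This makes the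
  approximants B positive, and positivity bounds the polynomials on upper half discs by a constant
  that does not depend on the radius; otherwise the half circle would not become negligible.\<close>

lemma scaleC_minus_left: "(- a) *\<^sub>C x = - (a *\<^sub>C (x::'a::complex_inner))"
  by (rule complex_vector.scale_minus_left)

lemma cinner_add_right: "cinner x (y + z) = cinner x y + cinner x (z::'a::complex_inner)"
  by (metis cinner_add_left cinner_commute complex_cnj_add)

lemma cinner_scaleC_right: "cinner x (a *\<^sub>C y) = a * cinner x (y::'a::complex_inner)"
  by (metis cinner_commute cinner_scaleC_left complex_cnj_cnj complex_cnj_mult)

lemma cinner_scaleR_left: "cinner (r *\<^sub>R x) y = of_real r * cinner x (y::'a::complex_inner)"
  by (simp add: scaleR_scaleC cinner_scaleC_left)

lemma cinner_scaleR_right: "cinner x (r *\<^sub>R y) = of_real r * cinner x (y::'a::complex_inner)"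
  by (simp add: scaleR_scaleC cinner_scaleC_right)

lemma cinner_self: "cinner x x = of_real ((norm (x::'a::complex_inner))\<^sup>2)"
proof (rule complex_eqI)
  show "Re (cinner x x) = Re (of_real ((norm x)\<^sup>2))"
    by (simp add: power2_norm_eq_inner inner_eq_Re_cinner)
  have "cinner x x = cnj (cinner x x)"
    by (rule cinner_commute)
  then show "Im (cinner x x) = Im (of_real ((norm x)\<^sup>2))"
    by (metis Im_complex_of_real Reals_cnj_iff complex_is_Real_iff)
qed

lemma norm_scaleC: "norm (a *\<^sub>C x) = norm a * norm (x::'a::complex_inner)"
proof -
  have "complex_of_real ((norm (a *\<^sub>C x))\<^sup>2) = of_real ((norm a * norm x)\<^sup>2)"
    by (simp add: cinner_self[symmetric] cinner_scaleC_left cinner_scaleC_right power_mult_distrib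
        complex_norm_square del: of_real_power)
       (simp add: cinner_self mult_ac flip: complex_norm_square)
  then show ?thesis
    by (metis of_real_eq_iff norm_ge_zero power2_eq_imp_eq zero_le_mult_iff)
qed

lemma norm_cinner_le: "norm (cinner x y) \<le> norm x * norm (y::'a::complex_inner)"
proof (cases "cinner x y = 0")
  case False
  \<comment> \<open>This unimodular number rotates the coefficient onto its modulus, so the real
    Cauchy-Schwarz inequality yields the complex one.\<close>
  define c where "c = cnj (cinner x y) / norm (cinner x y)"
  have c: "norm c = 1"
    using False by (simp add: c_def norm_divide)
  have "c * cinner x y = of_real (norm (cinner x y))"
    using False by (simp add: c_def field_simps power2_eq_square flip: complex_norm_square)
  then have "norm (cinner x y) = Re (cinner x (c *\<^sub>C y))"
    by (simp add: cinner_scaleC_right)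
  also have "\<dots> \<le> norm x * norm (c *\<^sub>C y)"
    by (metis inner_eq_Re_cinner Cauchy_Schwarz_ineq2 abs_le_D1)
  finally show ?thesis
    by (simp add: norm_scaleC c)
qed simp

lemma bounded_bilinear_cinner: "bounded_bilinear (cinner :: 'a::complex_inner \<Rightarrow> 'a \<Rightarrow> complex)"
  by (rule bounded_bilinear.intro)
    (auto simp: cinner_add_left cinner_add_right cinner_scaleR_left cinner_scaleR_right
      scaleR_conv_of_real intro!: exI[of _ 1] norm_cinner_le)

interpretation cinner: bounded_bilinear "cinner :: 'a::complex_inner \<Rightarrow> 'a \<Rightarrow> complex"
  by (rule bounded_bilinear_cinner)

lemma bounded_linear_scaleC: "bounded_linear ((*\<^sub>C) a :: 'a::complex_inner \<Rightarrow> 'a)"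
  by (rule bounded_linear_intro[of _ "norm a"])
    (auto simp: scaleC_add_right scaleR_scaleC scaleC_scaleC mult.commute norm_scaleC)

lemma norm_add_scaleC_sq:
  "(norm (x + a *\<^sub>C y))\<^sup>2 = (norm x)\<^sup>2 + 2 * Re (a * cinner x y) + (norm a)\<^sup>2 * (norm (y::'a::complex_inner))\<^sup>2"
proof -
  have "inner x (a *\<^sub>C y) = Re (a * cinner x y)"
    by (simp only: inner_eq_Re_cinner cinner_scaleC_right)
  moreover have "(norm a)\<^sup>2 * (norm y)\<^sup>2 = (norm (a *\<^sub>C y))\<^sup>2"
    by (simp add: norm_scaleC power_mult_distrib)
  ultimately show ?thesis
    using inner_commute[of "a *\<^sub>C y" x]
    by (simp only: power2_norm_eq_inner inner_add_left inner_add_right)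
qed

section \<open>Orthogonal projections and the Riesz theorem\<close>

lemma closed_subspace_nearest_point:
  fixes W :: "'a::chilbert_space set"
  assumes W: "closed W" "complex_vector.subspace W"
  shows "\<exists>p\<in>W. \<forall>s\<in>W. norm (x - p) \<le> norm (x - s)"
proof -
  have ne: "W \<noteq> {}"
    using W(2) complex_vector.subspace_0 by blast
  define d where "d = infdist x W"
  have d: "0 \<le> d" "\<And>s. s \<in> W \<Longrightarrow> d \<le> norm (x - s)"
    by (auto simp: d_def infdist_nonneg dist_norm[symmetric] intro: infdist_le)
  have "\<exists>s\<in>W. norm (x - s) < sqrt (d\<^sup>2 + 1 / Suc n)" for n
  proof -
    have "infdist x W < sqrt (d\<^sup>2 + 1 / Suc n)"
      unfolding d_def[symmetric] by (rule real_less_rsqrt) simp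
    then show ?thesis
      using cInf_lessD[of "dist x ` W"] ne by (auto simp: infdist_notempty dist_norm)
  qed
  then obtain s where s: "\<And>n. s n \<in> W" "\<And>n. norm (x - s n) < sqrt (d\<^sup>2 + 1 / Suc n)"
    by metis
  have s2: "(norm (x - s n))\<^sup>2 < d\<^sup>2 + 1 / Suc n" for n
    using s(2)[of n] by (metis norm_ge_zero real_sqrt_less_iff real_sqrt_unique)
  \<comment> \<open>The midpoint lies in \<open>W\<close>, hence at distance at least
    \<open>d\<close> from \<open>x\<close>; the parallelogram law turns the excess of the two
    squared distances into a Cauchy estimate.\<close>
  have close: "(norm (s m - s n))\<^sup>2 \<le> 2 / Suc m + 2 / Suc n" for m n
  proof -
    have "(1/2) *\<^sub>R (s m + s n) \<in> W"
      using W(2) s(1) by (metis complex_vector.subspace_add complex_vector.subspace_scale scaleR_scaleC)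
    from d(2)[OF this] have "d\<^sup>2 \<le> (norm (x - (1/2) *\<^sub>R (s m + s n)))\<^sup>2"
      using d(1) by (simp add: power_mono)
    moreover have "(norm (s m - s n))\<^sup>2 + 4 * (norm (x - (1/2) *\<^sub>R (s m + s n)))\<^sup>2
        = 2 * (norm (x - s m))\<^sup>2 + 2 * (norm (x - s n))\<^sup>2"
      by (simp add: power2_norm_eq_inner inner_diff_left inner_diff_right inner_add_left
          inner_add_right inner_commute algebra_simps)
    moreover have "2 / real (Suc k) = 2 * (1 / real (Suc k))" for k
      by simp
    ultimately show ?thesis
      using s2[of m] s2[of n] by linarith
  qed
  have "Cauchy s"
  proof (rule metric_CauchyI)
    fix e :: real assume "0 < e"
    then obtain M where M: "4 / e\<^sup>2 < real M"
      using reals_Archimedean2 by blast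
    show "\<exists>M. \<forall>m\<ge>M. \<forall>n\<ge>M. dist (s m) (s n) < e"
    proof (intro exI[of _ M] allI impI)
      fix m n assume mn: "m \<ge> M" "n \<ge> M"
      have "real M > 0"
        using M \<open>0 < e\<close> by (smt (verit) divide_nonneg_nonneg zero_le_power2)
      then have "2 / Suc m \<le> 2 / M" "2 / Suc n \<le> 2 / M"
        using mn by (auto intro!: divide_left_mono)
      moreover have "2 / real M + 2 / real M = 4 / real M"
        by simp
      moreover have "4 / real M < e\<^sup>2"
        using M \<open>real M > 0\<close> \<open>0 < e\<close> by (simp add: field_simps)
      ultimately have "(norm (s m - s n))\<^sup>2 < e\<^sup>2"
        using close[of m n] by linarith
      then show "dist (s m) (s n) < e"
        using \<open>0 < e\<close> by (simp add: dist_norm power_less_imp_less_base)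
    qed
  qed
  then obtain p where p: "s \<longlonglongrightarrow> p"
    using convergent_eq_Cauchy by blast
  then have "p \<in> W"
    using W(1) s(1) closed_sequentially by blast
  moreover have "norm (x - p) \<le> d"
  proof (rule LIMSEQ_le)
    show "(\<lambda>n. norm (x - s n)) \<longlonglongrightarrow> norm (x - p)"
      by (intro tendsto_intros p)
    have "(\<lambda>n. sqrt (d\<^sup>2 + 1 / Suc n)) \<longlonglongrightarrow> sqrt (d\<^sup>2 + 0)"
      by (intro tendsto_intros LIMSEQ_inverse_real_of_nat[unfolded inverse_eq_divide])
    then show "(\<lambda>n. sqrt (d\<^sup>2 + 1 / Suc n)) \<longlonglongrightarrow> d"
      using d(1) by simp
    show "\<exists>N. \<forall>n\<ge>N. norm (x - s n) \<le> sqrt (d\<^sup>2 + 1 / Suc n)"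
      using s(2) less_imp_le by blast
  qed
  ultimately show ?thesis
    using d(2) by (meson order_trans)
qed

lemma orthogonal_decomposition:
  fixes W :: "'a::chilbert_space set"
  assumes W: "closed W" "complex_vector.subspace W"
  shows "\<exists>p\<in>W. \<forall>s\<in>W. cinner s (x - p) = 0"
proof -
  obtain p where p: "p \<in> W" "\<And>s. s \<in> W \<Longrightarrow> norm (x - p) \<le> norm (x - s)"
    using closed_subspace_nearest_point[OF W] by blast
  have "cinner s (x - p) = 0" if s: "s \<in> W" for s
  proof (rule ccontr)
    assume nz: "cinner s (x - p) \<noteq> 0"
    then have "s \<noteq> 0"
      by (auto simp: cinner.zero_left)
    define c where "c = cinner s (x - p)"
    \<comment> \<open>The minimiser of the squared norm of \<open>x - p + a *\<^sub>C s\<close> over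
      all scalars; it undercuts the distance at \<open>p\<close> as soon as \<open>c\<close> is
      nonzero.\<close>
    define a where "a = - c / of_real ((norm s)\<^sup>2)"
    have xc: "cinner (x - p) s = cnj c"
      unfolding c_def by (rule cinner_commute)
    have "p - a *\<^sub>C s \<in> W"
      using W(2) p(1) s complex_vector.subspace_diff complex_vector.subspace_scale by blast
    from p(2)[OF this] have "(norm (x - p))\<^sup>2 \<le> (norm (x - p + a *\<^sub>C s))\<^sup>2"
      by (simp add: algebra_simps power_mono)
    also have "\<dots> = (norm (x - p))\<^sup>2 - (norm c)\<^sup>2 / (norm s)\<^sup>2"
    proof -
      have "a * cnj c = - of_real ((norm c)\<^sup>2 / (norm s)\<^sup>2)"
        by (simp add: a_def mult.commute flip: complex_norm_square)
      then have "Re (a * cnj c) = - ((norm c)\<^sup>2 / (norm s)\<^sup>2)"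
        by (simp del: of_real_divide of_real_power)
      moreover have "norm a = norm c / (norm s)\<^sup>2"
        by (simp add: a_def norm_divide norm_power)
      then have "(norm a)\<^sup>2 * (norm s)\<^sup>2 = (norm c)\<^sup>2 / (norm s)\<^sup>2"
        using \<open>s \<noteq> 0\<close> by (simp add: power_divide power2_eq_square)
      ultimately show ?thesis
        unfolding norm_add_scaleC_sq xc by simp
    qed
    finally show False
      using nz \<open>s \<noteq> 0\<close> by (simp add: c_def divide_le_0_iff)
  qed
  with p(1) show ?thesis
    by blast
qed

definition orthogonal_projection :: "'a::chilbert_space set \<Rightarrow> 'a \<Rightarrow> 'a"
  where "orthogonal_projection W x = (SOME p. p \<in> W \<and> (\<forall>s\<in>W. cinner s (x - p) = 0))"

context
  fixes W :: "'a::chilbert_space set"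
  assumes W: "closed W" "complex_vector.subspace W"
begin

lemma orthogonal_projection_in: "orthogonal_projection W x \<in> W"
  and orthogonal_projection_orthogonal: "s \<in> W \<Longrightarrow> cinner s (x - orthogonal_projection W x) = 0"
proof -
  have "orthogonal_projection W x \<in> W \<and> (\<forall>s\<in>W. cinner s (x - orthogonal_projection W x) = 0)"
    unfolding orthogonal_projection_def
    by (rule someI_ex) (use orthogonal_decomposition[OF W] in blast)
  then show "orthogonal_projection W x \<in> W"
    and "s \<in> W \<Longrightarrow> cinner s (x - orthogonal_projection W x) = 0"
    by blast+
qed

text \<open>The difference of two candidates lies in \<open>W\<close> and is orthogonal to
  \<open>W\<close>, hence to itself. Linearity and commutation with operators are deduced from this
  uniqueness.\<close>

lemma orthogonal_projection_eqI:
  assumes "p \<in> W" "\<And>s. s \<in> W \<Longrightarrow> cinner s (x - p) = 0"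
  shows "orthogonal_projection W x = p"
proof -
  let ?d = "orthogonal_projection W x - p"
  have d: "?d \<in> W"
    using W(2) assms(1) orthogonal_projection_in complex_vector.subspace_diff by blast
  have "cinner ?d ?d = cinner ?d ((x - p) - (x - orthogonal_projection W x))"
    by simp
  also have "\<dots> = 0"
    unfolding cinner.diff_right[of _ "x - p"]
    using d by (simp only: assms(2) orthogonal_projection_orthogonal) simp
  finally show ?thesis
    by (simp add: cinner_self)
qed

lemma orthogonal_projection_fixes: "x \<in> W \<Longrightarrow> orthogonal_projection W x = x"
  by (rule orthogonal_projection_eqI) (simp_all add: cinner.zero_right)

lemma cinner_orthogonal_projection:
  "cinner (orthogonal_projection W x) y = cinner x (orthogonal_projection W y)"
proof -
  have "cinner (orthogonal_projection W x) y
      = cinner (orthogonal_projection W x) (orthogonal_projection W y)" for x y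
    using orthogonal_projection_orthogonal[OF orthogonal_projection_in, of x y]
    by (simp add: cinner.diff_right)
  then show ?thesis
    by (metis cinner_commute)
qed

lemma norm_orthogonal_projection_le: "norm (orthogonal_projection W x) \<le> norm x"
proof -
  let ?p = "orthogonal_projection W x"
  have "complex_of_real ((norm ?p)\<^sup>2) = cinner ?p x"
    using orthogonal_projection_orthogonal[OF orthogonal_projection_in, of x x]
    by (simp only: cinner.diff_right cinner_self right_minus_eq)
  then have "(norm ?p)\<^sup>2 = norm (cinner ?p x)"
    by (metis norm_of_real abs_power2)
  also have "\<dots> \<le> norm ?p * norm x"
    by (rule norm_cinner_le)
  finally show ?thesis
    by (cases "norm ?p = 0") (simp_all add: power2_eq_square)
qed

lemma bounded_linear_orthogonal_projection: "bounded_linear (orthogonal_projection W)"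
proof (rule bounded_linear_intro[of _ 1])
  note [simp] = cinner.add_right cinner.diff_right cinner_scaleR_right
  have orth: "cinner s x = cinner s (orthogonal_projection W x)" if "s \<in> W" for s x
    using orthogonal_projection_orthogonal[OF that, of x] by simp
  show "orthogonal_projection W (x + y) = orthogonal_projection W x + orthogonal_projection W y" for x y
    by (rule orthogonal_projection_eqI)
      (auto simp: orth[symmetric] intro: complex_vector.subspace_add[OF W(2)] orthogonal_projection_in)
  show "orthogonal_projection W (r *\<^sub>R x) = r *\<^sub>R orthogonal_projection W x" for r x
    unfolding scaleR_scaleC
    by (rule orthogonal_projection_eqI)
      (auto simp: orth[symmetric] cinner_scaleC_right
        intro: complex_vector.subspace_scale[OF W(2)] orthogonal_projection_in)
qed (simp add: norm_orthogonal_projection_le)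

text \<open>\<open>V'\<close> is the adjoint of \<open>V\<close>. Since it preserves
  \<open>W\<close>, \<open>V\<close> preserves the orthogonal complement and maps the decomposition
  of \<open>x\<close> to that of \<open>V x\<close>.\<close>

lemma orthogonal_projection_commute:
  assumes "bounded_linear V" "V ` W \<subseteq> W" "V' ` W \<subseteq> W" "\<And>x y. cinner x (V y) = cinner (V' x) y"
  shows "orthogonal_projection W (V x) = V (orthogonal_projection W x)"
proof (rule orthogonal_projection_eqI)
  interpret bounded_linear V by fact
  show "V (orthogonal_projection W x) \<in> W"
    using assms(2) orthogonal_projection_in by blast
  show "cinner s (V x - V (orthogonal_projection W x)) = 0" if "s \<in> W" for s
    using assms(3) that
    by (simp add: diff[symmetric] assms(4) image_subset_iff orthogonal_projection_orthogonal)
qed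

end

text \<open>\<open>bounded_linear\<close> is real linearity, so complex homogeneity is demanded
  separately. The representing vector is a multiple of the component, orthogonal to the kernel, of a
  vector outside the kernel.\<close>

lemma riesz_representation:
  fixes \<phi> :: "'a::chilbert_space \<Rightarrow> complex"
  assumes "bounded_linear \<phi>" and scaleC: "\<And>a x. \<phi> (a *\<^sub>C x) = a * \<phi> x"
  shows "\<exists>v. \<forall>x. \<phi> x = cinner v x"
proof (cases "\<exists>x. \<phi> x \<noteq> 0")
  case True
  then obtain x0 where x0: "\<phi> x0 \<noteq> 0"
    by blast
  interpret bounded_linear \<phi> by fact
  let ?K = "{x. \<phi> x = 0}"
  have "closed ?K"
    using continuous_on_id by (intro closed_Collect_eq continuous_on continuous_on_const)
  moreover have "complex_vector.subspace ?K"
    by (auto simp: complex_vector.subspace_def add scaleC)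
  ultimately obtain p where p: "\<phi> p = 0" "\<And>s. \<phi> s = 0 \<Longrightarrow> cinner s (x0 - p) = 0"
    using orthogonal_decomposition[of ?K x0] by auto
  define z where "z = x0 - p"
  have z: "\<phi> z \<noteq> 0" "z \<noteq> 0"
    using p(1) x0 by (auto simp: z_def diff)
  have "\<phi> x = cinner ((cnj (\<phi> z) / of_real ((norm z)\<^sup>2)) *\<^sub>C z) x" for x
  proof -
    have "cinner (x - (\<phi> x / \<phi> z) *\<^sub>C z) z = 0"
      unfolding z_def by (rule p(2)) (use z in \<open>simp add: diff scaleC z_def\<close>)
    then have "cinner z (x - (\<phi> x / \<phi> z) *\<^sub>C z) = 0"
      by (metis cinner_commute complex_cnj_zero)
    then have "cinner z x = \<phi> x / \<phi> z * of_real ((norm z)\<^sup>2)"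
      by (simp add: cinner.diff_right cinner_scaleC_right cinner_self)
    then show ?thesis
      using z by (simp add: cinner_scaleC_left)
  qed
  then show ?thesis
    by blast
qed (auto intro: exI[of _ 0] simp: cinner.zero_left)

section \<open>Test functions on the upper half plane\<close>

text \<open>The strip below the real axis puts the axis inside an open convex domain of holomorphy,
  as Cauchy's theorem requires. Quadratic decay gives integrability on the line and a half-circle
  contribution of order 1/R.\<close>

definition upper_test :: "(complex \<Rightarrow> complex) \<Rightarrow> bool"
  where "upper_test g \<longleftrightarrow>
    (\<exists>d>0. g holomorphic_on {z. Im z > - d}) \<and>
    (\<exists>C. \<forall>z. Im z \<ge> 0 \<longrightarrow> norm (g z) \<le> C / (1 + (norm z)\<^sup>2))"

lemma one_plus_square_pos [simp]: "0 < 1 + (x::real)\<^sup>2"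
  by (simp add: add_pos_nonneg)

lemma integrable_Cauchy_kernel: "integrable lborel (\<lambda>t::real. 1 / (1 + t\<^sup>2))"
  using integrable_inverse_1_plus_square
  by (simp add: set_integrable_def inverse_eq_divide einterval_eq)

lemma upper_testI:
  assumes "d > 0" "g holomorphic_on {z. Im z > - d}"
    and "\<And>z. Im z \<ge> 0 \<Longrightarrow> norm (g z) \<le> C / (1 + (norm z)\<^sup>2)"
  shows "upper_test g"
  using assms unfolding upper_test_def by blast

lemma upper_testE:
  assumes "upper_test g"
  obtains d C where "d > 0" "g holomorphic_on {z. Im z > - d}" "C \<ge> 0"
    "\<And>z. Im z \<ge> 0 \<Longrightarrow> norm (g z) \<le> C / (1 + (norm z)\<^sup>2)"
proof -
  obtain d C where 1: "d > 0" "g holomorphic_on {z. Im z > - d}"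
    and 2: "\<And>z. Im z \<ge> 0 \<Longrightarrow> norm (g z) \<le> C / (1 + (norm z)\<^sup>2)"
    using assms unfolding upper_test_def by blast
  have "C \<ge> 0"
    using order_trans[OF norm_ge_zero 2[of 0]] by simp
  with 1 2 show ?thesis
    using that by blast
qed

lemma upper_test_continuous:
  assumes "upper_test g"
  shows "continuous_on UNIV (\<lambda>t::real. g (of_real t))"
proof -
  obtain d C where g: "d > 0" "g holomorphic_on {z. Im z > - d}"
    using assms by (rule upper_testE)
  have "continuous_on UNIV (g \<circ> complex_of_real)"
    by (rule continuous_on_compose)
      (auto intro!: continuous_intros continuous_on_subset[OF holomorphic_on_imp_continuous_on[OF g(2)]]
        simp: g(1))
  then show ?thesis
    by (simp add: o_def)
qed

lemma upper_test_integrable: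
  fixes k :: "real \<Rightarrow> complex"
  assumes "upper_test g" "continuous_on UNIV k" "\<And>t. norm (k t) \<le> K"
  shows "integrable lborel (\<lambda>t. g (of_real t) * k t)"
proof -
  obtain d C where g: "\<And>z. Im z \<ge> 0 \<Longrightarrow> norm (g z) \<le> C / (1 + (norm z)\<^sup>2)" "C \<ge> 0"
    using assms(1) by (rule upper_testE) blast
  have "K \<ge> 0"
    using assms(3)[of 0] norm_ge_zero order_trans by blast
  show ?thesis
  proof (rule Bochner_Integration.integrable_bound)
    show "integrable lborel (\<lambda>t. (C * K) * (1 / (1 + t\<^sup>2)))"
      by (intro integrable_mult_right integrable_Cauchy_kernel)
    show "(\<lambda>t. g (of_real t) * k t) \<in> borel_measurable lborel"
      using assms(2) upper_test_continuous[OF assms(1)]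
      by (auto intro!: borel_measurable_continuous_onI continuous_on_mult)
    have "norm (g (of_real t)) * norm (k t) \<le> C / (1 + t\<^sup>2) * K" for t
      using g(1)[of "of_real t"] assms(3)[of t] g(2) by (intro mult_mono) auto
    then show "AE t in lborel. norm (g (of_real t) * k t) \<le> norm (C * K * (1 / (1 + t\<^sup>2)))"
      using \<open>K \<ge> 0\<close> g(2) by (auto simp: norm_mult)
  qed
qed

text \<open>One factor supplies the decay, the other is merely bounded. This product merges the test
  functions of two energy conditions into one in \<open>energy_above_raise\<close>.\<close>

lemma upper_test_mult_shift:
  assumes "upper_test g" "upper_test q"
  shows "upper_test (\<lambda>z. g z * q (z + of_real a))"
proof -
  obtain d C where g: "d > 0" "g holomorphic_on {z. Im z > - d}" "C \<ge> 0"
    "\<And>z. Im z \<ge> 0 \<Longrightarrow> norm (g z) \<le> C / (1 + (norm z)\<^sup>2)"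
    using assms(1) by (rule upper_testE) blast
  obtain d' C' where q: "d' > 0" "q holomorphic_on {z. Im z > - d'}" "C' \<ge> 0"
    "\<And>z. Im z \<ge> 0 \<Longrightarrow> norm (q z) \<le> C' / (1 + (norm z)\<^sup>2)"
    using assms(2) by (rule upper_testE) blast
  show ?thesis
  proof (rule upper_testI)
    show "min d d' > 0"
      using g q by simp
    have "(q \<circ> (\<lambda>z. z + of_real a)) holomorphic_on {z. Im z > - min d d'}"
      by (rule holomorphic_on_compose_gen[OF _ q(2)]) (auto intro!: holomorphic_intros)
    then show "(\<lambda>z. g z * q (z + of_real a)) holomorphic_on {z. Im z > - min d d'}"
      by (intro holomorphic_on_mult holomorphic_on_subset[OF g(2)]) (auto simp: o_def)
    show "norm (g z * q (z + of_real a)) \<le> (C * C') / (1 + (norm z)\<^sup>2)" if "Im z \<ge> 0" for z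
    proof -
      have "norm (q (z + of_real a)) \<le> C' / (1 + (norm (z + of_real a))\<^sup>2)"
        using that by (intro q) simp
      also have "\<dots> \<le> C' / 1"
        using q(3) by (intro divide_left_mono) auto
      finally have "norm (g z) * norm (q (z + of_real a)) \<le> C / (1 + (norm z)\<^sup>2) * C'"
        using g(3) g(4)[OF that] by (intro mult_mono) auto
      then show ?thesis
        by (simp add: norm_mult)
    qed
  qed
qed

lemma upper_test_scale:
  assumes "upper_test g" "r > 0"
  shows "upper_test (\<lambda>z. g (of_real r * z))"
proof -
  obtain d C where g: "d > 0" "g holomorphic_on {z. Im z > - d}" "C \<ge> 0"
    "\<And>z. Im z \<ge> 0 \<Longrightarrow> norm (g z) \<le> C / (1 + (norm z)\<^sup>2)"
    using assms(1) by (rule upper_testE) blast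
  show ?thesis
  proof (rule upper_testI)
    show "d / r > 0"
      using g assms by simp
    have "(g \<circ> (\<lambda>z. of_real r * z)) holomorphic_on {z. Im z > - (d / r)}"
      using assms(2)
      by (intro holomorphic_on_compose_gen[OF _ g(2)]) (auto intro!: holomorphic_intros simp: field_simps)
    then show "(\<lambda>z. g (of_real r * z)) holomorphic_on {z. Im z > - (d / r)}"
      by (simp add: o_def)
    show "norm (g (of_real r * z)) \<le> (C * (1 + 1 / r\<^sup>2)) / (1 + (norm z)\<^sup>2)" if "Im z \<ge> 0" for z
    proof -
      have "norm (g (of_real r * z)) \<le> C / (1 + (norm (of_real r * z))\<^sup>2)"
        using that assms(2) by (intro g) simp
      also have "\<dots> = C / (1 + r\<^sup>2 * (norm z)\<^sup>2)"
        by (simp add: norm_mult power_mult_distrib)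
      also have "\<dots> \<le> (C * (1 + 1 / r\<^sup>2)) / (1 + (norm z)\<^sup>2)"
      proof -
        have "1 + (norm z)\<^sup>2 \<le> (1 + 1 / r\<^sup>2) * (1 + r\<^sup>2 * (norm z)\<^sup>2)"
          using assms(2) by (simp add: field_simps)
        then have "C * (1 + (norm z)\<^sup>2) \<le> C * ((1 + 1 / r\<^sup>2) * (1 + r\<^sup>2 * (norm z)\<^sup>2))"
          using g(3) by (rule mult_left_mono)
        moreover have "0 < 1 + r\<^sup>2 * (norm z)\<^sup>2"
          by (simp add: add_pos_nonneg)
        ultimately show ?thesis
          by (simp add: frac_le_eq divide_le_eq pos_le_divide_eq mult_ac)
      qed
      finally show ?thesis .
    qed
  qed
qed

text \<open>A single Cauchy kernel decays only like 1/z. The product of two has the required decay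
  and, for distinct poles, is a multiple of their difference, which is how Poisson kernels are
  compared in \<open>conjugate_constant\<close>.\<close>

lemma upper_test_Cauchy:
  assumes "Im v > 0" "Im w > 0"
  shows "upper_test (\<lambda>z. 1 / ((z + v) * (z + w)))"
proof -
  \<comment> \<open>\<open>norm z\<close> is controlled by the triangle inequality, and the
    constants by \<open>Im w \<le> norm (z + w)\<close>.\<close>
  have bound: "\<exists>C>0. \<forall>z. Im z \<ge> 0 \<longrightarrow> 1 + norm z \<le> C * norm (z + w)" if "Im w > 0" for w
  proof (intro exI[of _ "1 + (1 + norm w) / Im w"] conjI allI impI)
    show "0 < 1 + (1 + norm w) / Im w"
      using that by (simp add: add_pos_nonneg)
    fix z assume "Im z \<ge> 0"
    then have "Im w \<le> norm (z + w)"
      using abs_Im_le_cmod[of "z + w"] by simp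
    then have "1 + norm w \<le> (1 + norm w) / Im w * norm (z + w)"
      using that mult_left_mono[of "Im w" "norm (z + w)" "(1 + norm w) / Im w"]
      by (simp add: divide_nonneg_pos)
    moreover have "norm z \<le> norm (z + w) + norm w"
      using norm_triangle_ineq4[of "z + w" w] by simp
    ultimately show "1 + norm z \<le> (1 + (1 + norm w) / Im w) * norm (z + w)"
      by (simp add: distrib_right)
  qed
  obtain C1 where C1: "C1 > 0" "\<And>z. Im z \<ge> 0 \<Longrightarrow> 1 + norm z \<le> C1 * norm (z + v)"
    using bound[OF assms(1)] by blast
  obtain C2 where C2: "C2 > 0" "\<And>z. Im z \<ge> 0 \<Longrightarrow> 1 + norm z \<le> C2 * norm (z + w)"
    using bound[OF assms(2)] by blast
  show ?thesis
  proof (rule upper_testI)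
    show "min (Im v) (Im w) > 0"
      using assms by simp
    show "(\<lambda>z. 1 / ((z + v) * (z + w))) holomorphic_on {z. - min (Im v) (Im w) < Im z}"
      by (intro holomorphic_intros) (auto simp: add_eq_0_iff)
    show "norm (1 / ((z + v) * (z + w))) \<le> (C1 * C2) / (1 + (norm z)\<^sup>2)" if "Im z \<ge> 0" for z
    proof -
      have "1 + (norm z)\<^sup>2 \<le> (1 + norm z) * (1 + norm z)"
        by (simp add: power2_eq_square algebra_simps)
      also have "\<dots> \<le> (C1 * norm (z + v)) * (C2 * norm (z + w))"
        using that by (intro mult_mono C1 C2) (use C1(1) in \<open>auto intro: add_nonneg_nonneg\<close>)
      finally have "1 + (norm z)\<^sup>2 \<le> (C1 * C2) * (norm (z + v) * norm (z + w))"
        by (simp add: mult_ac)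
      moreover from this have "norm (z + v) * norm (z + w) > 0"
        using one_plus_square_pos[of "norm z"]
        by (smt (verit) mult_eq_0_iff mult_nonneg_nonneg norm_ge_zero)
      ultimately show ?thesis
        by (simp add: norm_divide norm_mult frac_le_eq divide_le_eq pos_le_divide_eq pos_divide_le_eq)
    qed
  qed
qed

text \<open>The base is i times the integral of exp (i s z) over s in [0,1], whence its value at 0.
  Its square carries frequencies in [0,2] only and decays quadratically in the upper half
  plane.\<close>

definition Fejer :: "complex \<Rightarrow> complex"
  where "Fejer z = (if z = 0 then \<i> else (exp (\<i> * z) - 1) / z)\<^sup>2"

lemma upper_test_Fejer: "upper_test Fejer"
proof -
  define \<phi> where "\<phi> z = (if z = 0 then \<i> else (exp (\<i> * z) - 1) / z)" for z
  have "deriv (\<lambda>z. exp (\<i> * z)) 0 = \<i>"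
    by (rule DERIV_imp_deriv) (auto intro!: derivative_eq_intros)
  then have hol: "\<phi> holomorphic_on UNIV"
    using pole_lemma[of "\<lambda>z. exp (\<i> * z)" UNIV 0]
    by (simp add: \<phi>_def[abs_def] holomorphic_intros cong: if_cong)
  then have "compact (\<phi> ` cball 0 1)"
    by (intro compact_continuous_image continuous_on_subset[OF holomorphic_on_imp_continuous_on]) auto
  then obtain B where B: "\<And>z. norm z \<le> 1 \<Longrightarrow> norm (\<phi> z) \<le> B"
    using compact_imp_bounded[of "\<phi> ` cball 0 1"] by (fastforce simp: bounded_iff)
  have F: "Fejer = (\<lambda>z. (\<phi> z)\<^sup>2)"
    by (auto simp: Fejer_def \<phi>_def)
  show ?thesis
  proof (rule upper_testI[of 1])
    show "Fejer holomorphic_on {z. - 1 < Im z}"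
      unfolding F by (intro holomorphic_on_power holomorphic_on_subset[OF hol]) auto
    show "norm (Fejer z) \<le> (2 * B\<^sup>2 + 8) / (1 + (norm z)\<^sup>2)" if "Im z \<ge> 0" for z
    proof (cases "norm z \<le> 1")
      case True
      have "norm (Fejer z) * (1 + (norm z)\<^sup>2) \<le> B\<^sup>2 * 2"
        using B[OF True] True
        by (intro mult_mono) (auto simp: F norm_power power_mono power_le_one)
      then show ?thesis
        by (simp add: pos_le_divide_eq)
    next
      case False
      have "norm (exp (\<i> * z) - 1) \<le> norm (exp (\<i> * z)) + norm (1::complex)"
        by (rule norm_triangle_ineq4)
      also have "\<dots> \<le> 2"
        using that by simp
      finally have "norm (\<phi> z) \<le> 2 / norm z"
        using False by (auto simp: \<phi>_def norm_divide divide_right_mono)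
      then have "(norm (\<phi> z))\<^sup>2 \<le> (2 / norm z)\<^sup>2"
        by (intro power_mono) auto
      moreover have "1 < (norm z)\<^sup>2"
        using False by simp
      ultimately have "norm (Fejer z) * (1 + (norm z)\<^sup>2) \<le> (4 / (norm z)\<^sup>2) * (2 * (norm z)\<^sup>2)"
        by (intro mult_mono) (auto simp: F norm_power power_divide)
      also have "\<dots> = 8"
        using \<open>1 < (norm z)\<^sup>2\<close> by (auto simp: field_simps)
      finally show ?thesis
        by (simp add: pos_le_divide_eq add_increasing)
    qed
  qed simp
qed

text \<open>The phase turns the test function into the negative of the classical Fejer kernel, whose
  integral is nonzero by positivity.\<close>

lemma Fejer_real: "exp (- \<i> * of_real t) * Fejer (of_real t)
  = - of_real (if t = 0 then 1 else (2 * sin (t / 2) / t)\<^sup>2)"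
proof (cases "t = 0")
  case False
  have "exp (\<i> * of_real t) - 1 = exp (\<i> * of_real (t / 2)) * (2 * \<i> * of_real (sin (t / 2)))"
  proof -
    have "2 * \<i> * of_real (sin (t / 2)) = exp (\<i> * of_real (t / 2)) - exp (- (\<i> * of_real (t / 2)))"
      by (simp add: sin_exp_eq' sin_of_real[symmetric] del: of_real_divide)
    then show ?thesis
      by (simp add: right_diff_distrib exp_add[symmetric] exp_minus)
  qed
  moreover have "(exp (\<i> * of_real (t / 2)))\<^sup>2 = exp (\<i> * of_real t)"
    by (simp add: exp_double[symmetric])
  ultimately have "Fejer (of_real t) = exp (\<i> * of_real t) * (2 * \<i> * of_real (sin (t / 2)))\<^sup>2 / of_real (t\<^sup>2)"
    using False by (simp add: Fejer_def power_mult_distrib power_divide)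
  then show ?thesis
    using False by (simp add: power_mult_distrib power_divide exp_minus)
qed (simp add: Fejer_def)

lemma Fejer_integral_nonzero: "(LINT t|lborel. exp (- \<i> * of_real t) * Fejer (of_real t)) \<noteq> 0"
proof
  define k where "k t = (if t = 0 then 1 else (2 * sin (t / 2) / t)\<^sup>2)" for t :: real
  have eq: "(\<lambda>t::real. exp (- \<i> * of_real t) * Fejer (of_real t)) = (\<lambda>t. - complex_of_real (k t))"
    unfolding Fejer_real k_def by simp
  \<comment> \<open>Continuity of \<open>k\<close> at 0 is inherited from the holomorphic function.
    It makes the zero set closed, so that vanishing almost everywhere reaches the point 0, where
    \<open>k\<close> is 1.\<close>
  have "continuous_on UNIV (\<lambda>t::real. exp (- \<i> * of_real t) * Fejer (of_real t))"
    by (intro continuous_intros upper_test_continuous upper_test_Fejer)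
  then have cont: "continuous_on UNIV k"
    using continuous_on_Re[OF continuous_on_minus, of UNIV "\<lambda>t. - complex_of_real (k t)"]
    unfolding eq by simp
  have "integrable lborel (\<lambda>t::real. Fejer (of_real t) * exp (- \<i> * of_real t))"
    by (rule upper_test_integrable[OF upper_test_Fejer, of _ 1]) (auto intro!: continuous_intros)
  then have "integrable lborel (\<lambda>t. complex_of_real (k t))"
    using integrable_minus[of lborel "\<lambda>t. - complex_of_real (k t)"]
    unfolding mult.commute[of "Fejer _"] eq by simp
  then have int: "integrable lborel k"
    by (simp only: complex_of_real_integrable_eq)
  assume "(LINT t|lborel. exp (- \<i> * of_real t) * Fejer (of_real t)) = 0"
  then have "integral\<^sup>L lborel k = 0"
    unfolding eq by simp
  then have "AE t in lborel. k t = 0"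
    using integral_nonneg_eq_0_iff_AE[OF int] by (simp add: k_def)
  then have "AE t in lebesgue. t \<in> {t. k t = 0}"
    by (simp add: AE_completion)
  moreover have "closed {t. k t = 0}"
    using cont by (intro closed_Collect_eq continuous_on_const)
  ultimately have "k 0 = 0"
    using mem_closed_if_AE_lebesgue[of "{t. k t = 0}" 0] by simp
  then show False
    by (simp add: k_def)
qed

text \<open>Dominated convergence. Besides concentrating a kernel at \<open>x\<close>, it is applied
  with a phase as \<open>h\<close>, to let a frequency tend to 0.\<close>

lemma approximate_identity:
  fixes \<kappa> h :: "real \<Rightarrow> complex"
  assumes "integrable lborel \<kappa>" "continuous_on UNIV h" "\<And>t. norm (h t) \<le> K" "a \<longlonglongrightarrow> 0"
  shows "(\<lambda>n. LINT s|lborel. \<kappa> s * h (x + a n * s)) \<longlonglongrightarrow> (LINT s|lborel. \<kappa> s) * h x"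
proof -
  have "(\<lambda>n. LINT s|lborel. \<kappa> s * h (x + a n * s)) \<longlonglongrightarrow> (LINT s|lborel. \<kappa> s * h x)"
  proof (rule integral_dominated_convergence[where w="\<lambda>s. K * norm (\<kappa> s)"])
    show "(\<lambda>s. \<kappa> s * h (x + a n * s)) \<in> borel_measurable lborel" for n
      using assms(1,2)
      by (intro borel_measurable_times)
        (auto intro!: borel_measurable_continuous_onI continuous_on_compose2[OF assms(2)] continuous_intros)
    show "AE s in lborel. (\<lambda>n. \<kappa> s * h (x + a n * s)) \<longlonglongrightarrow> \<kappa> s * h x"
    proof (rule AE_I2)
      fix s
      have "(\<lambda>n. x + a n * s) \<longlonglongrightarrow> x + 0 * s"
        by (intro tendsto_intros assms)
      then have "(\<lambda>n. h (x + a n * s)) \<longlonglongrightarrow> h (x + 0 * s)"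
        using assms(2) by (intro isCont_tendsto_compose[of _ h]) (auto simp: continuous_on_eq_continuous_at)
      then show "(\<lambda>n. \<kappa> s * h (x + a n * s)) \<longlonglongrightarrow> \<kappa> s * h x"
        by (intro tendsto_intros) simp
    qed
    show "AE s in lborel. norm (\<kappa> s * h (x + a n * s)) \<le> K * norm (\<kappa> s)" for n
      using assms(3) by (intro AE_I2) (simp add: norm_mult mult.commute[of K] mult_left_mono)
  qed (use assms(1) in auto)
  then show ?thesis
    using assms(1) by simp
qed

section \<open>Contour shift onto half circles\<close>

lemma upper_test_half_disc:
  assumes g: "d > 0" "g holomorphic_on {z. Im z > - d}"
    "\<And>z. Im z \<ge> 0 \<Longrightarrow> norm (g z) \<le> C / (1 + (norm z)\<^sup>2)"
    and p: "p holomorphic_on UNIV" "\<And>z. Im z \<ge> 0 \<Longrightarrow> norm z \<le> R \<Longrightarrow> norm (p z) \<le> K"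
    and R: "R > 0" and nn: "C \<ge> 0" "K \<ge> 0"
  shows "norm (integral {-R..R} (\<lambda>t. g (of_real t) * p (of_real t))) \<le> pi * C * K / R"
proof -
  let ?f = "\<lambda>z. g z * p z" and ?S = "{z. Im z > - d}"
  let ?l = "linepath (of_real (- R)) (of_real R) :: real \<Rightarrow> complex"
  let ?c = "part_circlepath 0 R 0 pi"
  have hol: "?f holomorphic_on ?S"
    by (intro holomorphic_on_mult g holomorphic_on_subset[OF p(1)]) auto
  have conv: "convex ?S"
    using convex_halfspace_Im_gt[of "- d"] by simp
  have op: "open ?S"
    by (rule open_halfspace_Im_gt)
  have S1: "path_image ?l \<subseteq> ?S"
    using g(1) by (auto simp: path_image_linepath closed_segment_def)
  have arc: "Im z \<ge> 0 \<and> norm z = R" if "z \<in> path_image ?c" for z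
    using that R
    by (auto simp: path_image_part_circlepath' norm_mult closed_segment_eq_real_ivl sin_ge_zero cis_conv_exp[symmetric])
  have S2: "path_image ?c \<subseteq> ?S"
    using arc g(1) by fastforce
  have i1: "?f contour_integrable_on ?l" and i2: "?f contour_integrable_on ?c"
    using contour_integrable_holomorphic_simple[OF hol op _ S1]
      contour_integrable_holomorphic_simple[OF hol op _ S2] by simp_all
  have fin: "pathfinish ?l = pathstart ?c" "pathfinish ?c = pathstart ?l"
    by (auto simp: exp_pi_i')
  have "(?f has_contour_integral 0) (?l +++ ?c)"
    using S1 S2 fin by (intro Cauchy_theorem_convex_simple[OF hol conv]) (auto intro!: valid_path_join simp: path_image_join)
  then have "contour_integral ?l ?f + contour_integral ?c ?f = 0"
    using contour_integral_join[OF i1 i2] fin by (simp add: contour_integral_unique)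
  then have "norm (contour_integral ?l ?f) = norm (contour_integral ?c ?f)"
    by (metis add_eq_0_iff norm_minus_cancel)
  \<comment> \<open>On the arc the quadratic decay of \<open>g\<close> outweighs the length
    \<open>pi * R\<close>, leaving one factor 1/R.\<close>
  also have "\<dots> \<le> (C / (1 + R\<^sup>2) * K) * R * \<bar>pi - 0\<bar>"
  proof (rule contour_integral_bound_part_circlepath[OF i2])
    show "norm (g z * p z) \<le> C / (1 + R\<^sup>2) * K" if "z \<in> path_image ?c" for z
      using arc[OF that] mult_mono[OF g(3) p(2), of z z] nn by (auto simp: norm_mult)
  qed (use R nn in auto)
  also have "\<dots> = (C * K * R * pi) * (1 / (1 + R\<^sup>2))"
    by simp
  also have "\<dots> \<le> (C * K * R * pi) * (1 / R\<^sup>2)"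
    using R nn by (intro mult_left_mono divide_left_mono) auto
  also have "\<dots> = pi * C * K / R"
    using R by (simp add: power2_eq_square)
  finally show ?thesis
    using R by (simp add: contour_integral_linepath_Reals_eq)
qed

text \<open>Entire approximants on bounded intervals replace a holomorphic extension of
  \<open>h\<close>. The point is that \<open>M\<close> depends neither on \<open>R\<close> nor on
  \<open>e\<close>: first \<open>e\<close> tends to 0 for fixed \<open>R\<close>, then
  \<open>R\<close> tends to infinity.\<close>

lemma upper_test_integral_eq_0:
  fixes h :: "real \<Rightarrow> complex"
  assumes g: "upper_test g" and h: "continuous_on UNIV h" "\<And>t. norm (h t) \<le> K"
    and approx: "\<And>R e. R > 0 \<Longrightarrow> e > 0 \<Longrightarrow> \<exists>p. p holomorphic_on UNIV \<and>
        (\<forall>z. Im z \<ge> 0 \<and> norm z \<le> R \<longrightarrow> norm (p z) \<le> M) \<and>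
        (\<forall>t. \<bar>t\<bar> \<le> R \<longrightarrow> norm (p (of_real t) - h t) \<le> e)"
  shows "(LINT t|lborel. g (of_real t) * h t) = 0"
proof -
  obtain d C where g': "d > 0" "g holomorphic_on {z. Im z > - d}" "C \<ge> 0"
    "\<And>z. Im z \<ge> 0 \<Longrightarrow> norm (g z) \<le> C / (1 + (norm z)\<^sup>2)"
    using g by (rule upper_testE) blast
  let ?f = "\<lambda>t. g (of_real t) * h t"
  note gc = upper_test_continuous[OF g]
  have int: "integrable lborel ?f"
    by (rule upper_test_integrable[OF g h])
  have M: "M \<ge> 0"
    using approx[of 1 1] norm_ge_zero order_trans by (metis Im_complex_of_real norm_zero of_real_0 order_refl zero_le_one zero_less_one)
  have bound: "norm (integral {-R..R} ?f) \<le> pi * C * M / R" if R: "R > 0" for R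
  proof (rule field_le_epsilon)
    fix e :: real assume e: "e > 0"
    \<comment> \<open>The interval has length \<open>2 * R\<close> and \<open>g\<close> is bounded
      by \<open>C\<close> on it; the summand 1 covers the case \<open>C = 0\<close>.\<close>
    define e' where "e' = e / (2 * R * C + 1)"
    have RC: "2 * R * C + 1 > 0"
      using R g'(3) by (simp add: add_nonneg_pos)
    have e': "e' > 0"
      using e RC by (simp add: e'_def)
    obtain p where p: "p holomorphic_on UNIV" "\<And>z. Im z \<ge> 0 \<Longrightarrow> norm z \<le> R \<Longrightarrow> norm (p z) \<le> M"
      "\<And>t. \<bar>t\<bar> \<le> R \<Longrightarrow> norm (p (of_real t) - h t) \<le> e'"
      using approx[OF R e'] by blast
    have pc: "continuous_on UNIV (\<lambda>t::real. p (of_real t))"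
      by (rule continuous_on_compose2[OF holomorphic_on_imp_continuous_on[OF p(1)]])
        (auto intro!: continuous_intros)
    have ii: "(\<lambda>t. g (of_real t) * p (of_real t)) integrable_on {-R..R}" "?f integrable_on {-R..R}"
      by (auto intro!: integrable_continuous_real continuous_on_mult
          continuous_on_subset[OF gc] continuous_on_subset[OF pc] continuous_on_subset[OF h(1)])
    have "norm (integral {-R..R} ?f - integral {-R..R} (\<lambda>t. g (of_real t) * p (of_real t)))
        = norm (integral (cbox (-R) R) (\<lambda>t. g (of_real t) * (h t - p (of_real t))))"
      using ii by (simp add: integral_diff[symmetric] right_diff_distrib)
    also have "\<dots> \<le> (C * e') * Sigma_Algebra.measure lborel (cbox (-R) R)"
    proof (rule integrable_bound)
      show "0 \<le> C * e'"
        using g' e' by simp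
      show "(\<lambda>t. g (of_real t) * (h t - p (of_real t))) integrable_on cbox (-R) R"
        using integrable_diff[OF ii(2,1)] by (simp add: right_diff_distrib)
      fix t assume "t \<in> cbox (-R) R"
      then have t: "\<bar>t\<bar> \<le> R"
        by auto
      have "norm (g (of_real t)) \<le> C / (1 + t\<^sup>2)"
        using g'(4)[of "of_real t"] by simp
      also have "\<dots> \<le> C / 1"
        using g'(3) by (intro divide_left_mono) auto
      finally show "norm (g (of_real t) * (h t - p (of_real t))) \<le> C * e'"
        using p(3)[OF t] g'(3) by (auto simp: norm_mult norm_minus_commute intro!: mult_mono)
    qed
    also have "\<dots> = (2 * R * C) * e'"
      using R by simp
    also have "\<dots> \<le> (2 * R * C + 1) * e'"
      using e' by (intro mult_right_mono) auto
    also have "\<dots> = e"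
      using RC by (simp add: e'_def)
    finally show "norm (integral {-R..R} ?f) \<le> pi * C * M / R + e"
      using upper_test_half_disc[OF g'(1,2,4) p(1,2) R g'(3) M] norm_triangle_sub
      by (smt (verit))
  qed
  have lim: "(\<lambda>n. LINT t|lborel. indicator {- real (Suc n)..real (Suc n)} t *\<^sub>R ?f t) \<longlonglongrightarrow> (LINT t|lborel. ?f t)"
  proof (rule integral_dominated_convergence[where w="\<lambda>t. norm (?f t)"])
    show "AE t in lborel. (\<lambda>n. indicator {- real (Suc n)..real (Suc n)} t *\<^sub>R ?f t) \<longlonglongrightarrow> ?f t"
    proof (rule AE_I2)
      fix t :: real
      obtain N where N: "\<bar>t\<bar> \<le> real N"
        using real_arch_simple by blast
      have "eventually (\<lambda>n. indicator {- real (Suc n)..real (Suc n)} t *\<^sub>R ?f t = ?f t) sequentially"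
        using eventually_ge_at_top[of N] by eventually_elim (use N in \<open>auto simp: indicator_def\<close>)
      then show "(\<lambda>n. indicator {- real (Suc n)..real (Suc n)} t *\<^sub>R ?f t) \<longlonglongrightarrow> ?f t"
        by (rule tendsto_eventually)
    qed
  qed (use int in \<open>auto simp: indicator_def intro!: borel_measurable_scaleR\<close>)
  have eq: "(LINT t|lborel. indicator {-R..R} t *\<^sub>R ?f t) = integral {-R..R} ?f" for R
    using set_borel_integral_eq_integral(2)[of "{-R..R}" ?f] int
    by (simp add: set_lebesgue_integral_def set_integrable_def integrable_mult_indicator)
  have "eventually (\<lambda>n. norm (LINT t|lborel. indicator {- real (Suc n)..real (Suc n)} t *\<^sub>R ?f t)
      \<le> pi * C * M * (1 / real (Suc n))) sequentially"
    unfolding eq using bound[of "real (Suc _)"] by (simp del: of_nat_Suc)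
  moreover have "(\<lambda>n. pi * C * M * (1 / real (Suc n))) \<longlonglongrightarrow> 0"
    using tendsto_mult_left[OF LIMSEQ_inverse_real_of_nat[unfolded inverse_eq_divide], of "pi * C * M"]
    by (simp only: mult_zero_right)
  ultimately have "(\<lambda>n. LINT t|lborel. indicator {- real (Suc n)..real (Suc n)} t *\<^sub>R ?f t) \<longlonglongrightarrow> 0"
    by (rule Lim_null_comparison)
  with lim show ?thesis
    by (rule LIMSEQ_unique)
qed

section \<open>Unitary flows and their generators\<close>

lemma integrable_mult_bounded_continuous:
  fixes f k :: "real \<Rightarrow> complex"
  assumes "integrable lborel f" "continuous_on UNIV k" "\<And>t. norm (k t) \<le> K"
  shows "integrable lborel (\<lambda>t. f t * k t)"
proof (rule Bochner_Integration.integrable_bound)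
  show "integrable lborel (\<lambda>t. K * norm (f t))"
    using assms(1) by simp
  have "k \<in> borel_measurable lborel"
    using assms(2) by (simp add: borel_measurable_continuous_onI)
  then show "(\<lambda>t. f t * k t) \<in> borel_measurable lborel"
    using borel_measurable_integrable[OF assms(1)] by (intro borel_measurable_times)
  show "AE t in lborel. norm (f t * k t) \<le> norm (K * norm (f t))"
  proof (rule AE_I2)
    fix t
    have "norm (f t) * norm (k t) \<le> norm (f t) * \<bar>K\<bar>"
      using assms(3)[of t] by (intro mult_left_mono) auto
    then show "norm (f t * k t) \<le> norm (K * norm (f t))"
      by (simp add: norm_mult abs_mult mult.commute)
  qed
qed

lemma norm_integral_mult_le:
  fixes f k :: "real \<Rightarrow> complex"
  assumes "integrable lborel f" "continuous_on UNIV k" "\<And>t. norm (k t) \<le> K"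
  shows "norm (LINT t|lborel. f t * k t) \<le> (LINT t|lborel. norm (f t)) * K"
proof -
  have "norm (LINT t|lborel. f t * k t) \<le> (LINT t|lborel. norm (f t * k t))"
    by (rule integral_norm_bound)
  also have "\<dots> \<le> (LINT t|lborel. norm (f t) * K)"
    using integrable_norm[OF integrable_mult_bounded_continuous[OF assms]] assms(1,3)
    by (intro integral_mono) (auto simp: norm_mult mult_left_mono)
  finally show ?thesis
    by simp
qed

context
  fixes f :: "real \<Rightarrow> complex" and k :: "real \<Rightarrow> 'h::chilbert_space" and K :: real
  assumes f: "integrable lborel f" and k: "continuous_on UNIV k" "\<And>t. norm (k t) \<le> K"
begin

lemma continuous_cinner_const:
  "continuous_on UNIV (\<lambda>t. cinner x (k t))" "continuous_on UNIV (\<lambda>t. cinner (k t) x)"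
  by (intro cinner.continuous_on continuous_on_const k)+

lemma norm_cinner_const_le:
  "norm (cinner x (k t)) \<le> norm x * K" "norm (cinner (k t) x) \<le> norm x * K"
  using norm_cinner_le[of x "k t"] norm_cinner_le[of "k t" x] mult_left_mono[OF k(2)[of t], of "norm x"]
  by (auto simp: mult.commute intro: order_trans)

lemma integrable_mult_cinner:
  "integrable lborel (\<lambda>t. f t * cinner x (k t))" "integrable lborel (\<lambda>t. f t * cinner (k t) x)"
  by (rule integrable_mult_bounded_continuous[OF f continuous_cinner_const(1) norm_cinner_const_le(1)]
      integrable_mult_bounded_continuous[OF f continuous_cinner_const(2) norm_cinner_const_le(2)])+

text \<open>Substitute for a vector-valued integral: boundedness in the free argument makes
  annihilators closed and, for the companion in the other slot, opens the way to
  \<open>riesz_representation\<close>.\<close>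

lemma bounded_linear_integral_cinner_left: "bounded_linear (\<lambda>x. LINT t|lborel. f t * cinner x (k t))"
proof (rule bounded_linear_intro)
  show "norm (LINT t|lborel. f t * cinner x (k t)) \<le> norm x * ((LINT t|lborel. norm (f t)) * K)" for x
    using norm_integral_mult_le[OF f continuous_cinner_const(1) norm_cinner_const_le(1)]
    by (simp add: mult_ac)
qed (simp_all add: cinner_add_left cinner_scaleR_left distrib_left integrable_mult_cinner
    mult.left_commute[of "f _"] scaleR_conv_of_real)

lemma bounded_linear_integral_cinner_right: "bounded_linear (\<lambda>x. LINT t|lborel. f t * cinner (k t) x)"
proof (rule bounded_linear_intro)
  show "norm (LINT t|lborel. f t * cinner (k t) x) \<le> norm x * ((LINT t|lborel. norm (f t)) * K)" for x
    using norm_integral_mult_le[OF f continuous_cinner_const(2) norm_cinner_const_le(2)]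
    by (simp add: mult_ac)
qed (simp_all add: cinner_add_right cinner_scaleR_right distrib_left integrable_mult_cinner
    mult.left_commute[of "f _"] scaleR_conv_of_real)

end

locale unitary_flow =
  fixes U :: "real \<Rightarrow> 'h::chilbert_space \<Rightarrow> 'h"
  assumes U_0: "U 0 x = x"
    and U_add: "U (s + t) x = U s (U t x)"
    and U_plus: "U t (x + y) = U t x + U t y"
    and U_scaleC: "U t (a *\<^sub>C x) = a *\<^sub>C U t x"
    and U_cinner: "cinner (U t x) (U t y) = cinner x y"
    and U_continuous: "continuous_on UNIV (\<lambda>t. U t x)"
begin

lemma U_norm [simp]: "norm (U t x) = norm x"
proof -
  have "complex_of_real ((norm (U t x))\<^sup>2) = of_real ((norm x)\<^sup>2)"
    unfolding cinner_self[symmetric] by (rule U_cinner)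
  then show ?thesis
    by (metis norm_ge_zero of_real_eq_iff power2_eq_imp_eq)
qed

lemma U_inverse: "U (- t) (U t x) = x" "U t (U (- t) x) = x"
  using U_add[of "- t" t x] U_add[of t "- t" x] by (simp_all add: U_0)

lemma U_adjoint: "cinner (U t x) y = cinner x (U (- t) y)"
  using U_cinner[of t x "U (- t) y"] by (simp add: U_inverse)

lemma U_bounded_linear: "bounded_linear (U t)"
  by (rule bounded_linear_intro[of _ 1]) (auto simp: U_plus U_scaleC scaleR_scaleC)

lemmas U_diff = bounded_linear.linear[OF U_bounded_linear, THEN linear_diff]

text \<open>Strong continuity becomes joint continuity because every \<open>U t\<close> is
  isometric, so a change of the vector is not amplified.\<close>

lemma continuous_on_U:
  assumes "continuous_on S f" "continuous_on S g"
  shows "continuous_on S (\<lambda>x. U (f x) (g x))"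
  unfolding continuous_on_def
proof
  fix a assume a: "a \<in> S"
  have f: "(f \<longlongrightarrow> f a) (at a within S)" and g: "(g \<longlongrightarrow> g a) (at a within S)"
    using assms a by (auto simp: continuous_on_def)
  have "isCont (\<lambda>t. U t (g a)) (f a)"
    using U_continuous continuous_on_eq_continuous_at open_UNIV by blast
  then have lim: "((\<lambda>x. norm (g x - g a) + norm (U (f x) (g a) - U (f a) (g a))) \<longlongrightarrow> 0) (at a within S)"
    using tendsto_add[OF tendsto_norm_zero[OF LIM_zero[OF g]]
        tendsto_norm_zero[OF LIM_zero[OF isCont_tendsto_compose[OF _ f]]]] by simp
  have "norm (U (f x) (g x) - U (f a) (g a))
      \<le> norm (g x - g a) + norm (U (f x) (g a) - U (f a) (g a))" for x
    using norm_triangle_ineq[of "U (f x) (g x - g a)" "U (f x) (g a) - U (f a) (g a)"]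
    by (simp only: U_norm) (simp add: U_diff)
  then have "((\<lambda>x. U (f x) (g x) - U (f a) (g a)) \<longlongrightarrow> 0) (at a within S)"
    by (intro Lim_null_comparison[OF _ lim] always_eventually allI)
  then show "((\<lambda>x. U (f x) (g x)) \<longlongrightarrow> U (f a) (g a)) (at a within S)"
    by (rule LIM_zero_cancel)
qed

definition dom :: "'h set"
  where "dom = {v. \<exists>w. ((\<lambda>t. U t v) has_vector_derivative w) (at 0)}"

definition gen :: "'h \<Rightarrow> 'h"
  where "gen v = (- \<i>) *\<^sub>C vector_derivative (\<lambda>t. U t v) (at 0)"

lemma has_derivative_U:
  assumes "v \<in> dom"
  shows "((\<lambda>t. U t v) has_vector_derivative \<i> *\<^sub>C gen v) (at 0)"
  using assms by (auto simp: dom_def gen_def scaleC_scaleC scaleC_one vector_derivative_at)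

lemma genI:
  assumes "((\<lambda>t. U t v) has_vector_derivative \<i> *\<^sub>C w) (at 0)"
  shows "v \<in> dom" "gen v = w"
  using assms by (auto simp: dom_def gen_def scaleC_scaleC scaleC_one vector_derivative_at)

lemma U_dom:
  assumes "v \<in> dom"
  shows "U s v \<in> dom" "gen (U s v) = U s (gen v)"
proof -
  have "((\<lambda>t. U s (U t v)) has_vector_derivative U s (\<i> *\<^sub>C gen v)) (at 0)"
    by (rule bounded_linear.has_vector_derivative[OF U_bounded_linear has_derivative_U[OF assms]])
  then have "((\<lambda>t. U t (U s v)) has_vector_derivative \<i> *\<^sub>C U s (gen v)) (at 0)"
    by (simp add: U_scaleC U_add[symmetric] add.commute)
  then show "U s v \<in> dom" "gen (U s v) = U s (gen v)"
    by (rule genI)+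
qed

text \<open>Both sides come from differentiating \<open>U_adjoint\<close> at 0. The sign from
  reflecting time matches the one from antilinearity in the first slot.\<close>

lemma gen_symmetric:
  assumes "v \<in> dom" "w \<in> dom"
  shows "cinner (gen v) w = cinner v (gen w)"
proof -
  have 1: "((\<lambda>t. cinner (U t v) w) has_vector_derivative cinner (\<i> *\<^sub>C gen v) w) (at 0)"
    by (rule bounded_linear.has_vector_derivative[OF cinner.bounded_linear_left has_derivative_U[OF assms(1)]])
  have "((\<lambda>t. U t w) \<circ> uminus has_vector_derivative (-1) *\<^sub>R (\<i> *\<^sub>C gen w)) (at 0)"
    by (rule vector_diff_chain_at) (use has_derivative_U[OF assms(2)] in \<open>auto intro!: derivative_eq_intros\<close>)
  then have "((\<lambda>t. cinner v (U (- t) w)) has_vector_derivative cinner v (- (\<i> *\<^sub>C gen w))) (at 0)"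
    by (intro bounded_linear.has_vector_derivative[OF cinner.bounded_linear_right]) (simp add: o_def)
  then have "((\<lambda>t. cinner (U t v) w) has_vector_derivative cinner v (- (\<i> *\<^sub>C gen w))) (at 0)"
    by (simp add: U_adjoint)
  from vector_derivative_unique_at[OF 1 this] show ?thesis
    by (simp add: cinner_scaleC_left cinner_scaleC_right cinner.minus_right)
qed

text \<open>This is the inverse of A + c; the spectral parameter - c is kept in the form in which
  \<open>resolvent_set\<close> presents it.\<close>

definition resolvent :: "real \<Rightarrow> 'h \<Rightarrow> 'h"
  where "resolvent c = inv_into dom (\<lambda>v. gen v - (- of_real c) *\<^sub>C v)"

end

section \<open>Norm bound for the resolvent\<close>

lemma norm_diff_scaleR_sq:
  "(norm (x - a *\<^sub>R y))\<^sup>2 = (norm x)\<^sup>2 - 2 * a * inner x y + a\<^sup>2 * (norm (y::'a::real_inner))\<^sup>2"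
  unfolding power2_norm_eq_inner
  by (simp add: inner_diff_left inner_diff_right inner_commute[of y x] power2_eq_square algebra_simps)

text \<open>A unit vector \<open>x\<close> with \<open>norm (T x)\<close> close to \<open>onorm T\<close> is almost annihilated by
  \<open>1 - s\<^sup>2 T\<^sup>2 = (1 - s T) (1 + s T)\<close>, so the two factors cannot both be bounded below.\<close>

lemma norm_bound_not_attained:
  fixes T :: "'h::chilbert_space \<Rightarrow> 'h"
  assumes "bounded_linear T" and sa: "\<And>x y. cinner (T x) y = cinner x (T y)"
    and s: "s = 1 / onorm T" "onorm T > 0"
    and K1: "\<And>x. norm x \<le> K1 * norm (x - s *\<^sub>R T x)"
    and K2: "\<And>x. norm x \<le> K2 * norm (x + s *\<^sub>R T x)"
  shows False
proof -
  interpret T: bounded_linear T by fact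
  \<comment> \<open>Absolute values and the summands 1 ensure \<open>K \<ge> 1\<close>, so that
    \<open>1 - 1 / K\<^sup>2\<close> is nonnegative.\<close>
  define K where "K = (1 + \<bar>K1\<bar>) * (1 + \<bar>K2\<bar>)"
  have K: "K \<ge> 1"
    unfolding K_def using mult_mono[of 1 "1 + \<bar>K1\<bar>" 1 "1 + \<bar>K2\<bar>"] by simp
  have spos: "s > 0"
    using s by simp
  \<comment> \<open>No almost maximal vector is chosen: the estimate holds for all \<open>x\<close>
    with a factor strictly below \<open>onorm T\<close>, against the minimality of the operator
    norm.\<close>
  have "norm (T x) \<le> (onorm T * sqrt (1 - 1 / K\<^sup>2)) * norm x" for x
  proof -
    have inn: "inner x (T (T x)) = (norm (T x))\<^sup>2"
      by (simp add: inner_eq_Re_cinner sa[symmetric] cinner_self del: of_real_power)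
    have "norm x \<le> K2 * norm (x + s *\<^sub>R T x)"
      by (rule K2)
    also have "\<dots> \<le> (1 + \<bar>K2\<bar>) * norm (x + s *\<^sub>R T x)"
      by (intro mult_right_mono) auto
    also have "norm (x + s *\<^sub>R T x) \<le> (1 + \<bar>K1\<bar>) * norm ((x + s *\<^sub>R T x) - s *\<^sub>R T (x + s *\<^sub>R T x))"
      using K1 by (rule order_trans) (intro mult_right_mono, auto)
    also have "(x + s *\<^sub>R T x) - s *\<^sub>R T (x + s *\<^sub>R T x) = x - s\<^sup>2 *\<^sub>R T (T x)"
      by (simp add: T.add T.scaleR algebra_simps power2_eq_square)
    finally have "norm x \<le> (1 + \<bar>K2\<bar>) * ((1 + \<bar>K1\<bar>) * norm (x - s\<^sup>2 *\<^sub>R T (T x)))"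
      by (simp add: mult_left_mono)
    then have "norm x \<le> K * norm (x - s\<^sup>2 *\<^sub>R T (T x))"
      by (simp add: K_def mult_ac)
    then have "(norm x)\<^sup>2 \<le> (K * norm (x - s\<^sup>2 *\<^sub>R T (T x)))\<^sup>2"
      by (intro power_mono) auto
    also have "\<dots> = K\<^sup>2 * ((norm x)\<^sup>2 - 2 * s\<^sup>2 * (norm (T x))\<^sup>2 + s^4 * (norm (T (T x)))\<^sup>2)"
      unfolding power_mult_distrib norm_diff_scaleR_sq inn by (simp add: power_numeral_reduce)
    also have "\<dots> \<le> K\<^sup>2 * ((norm x)\<^sup>2 - s\<^sup>2 * (norm (T x))\<^sup>2)"
    proof -
      have "norm (T (T x)) \<le> onorm T * norm (T x)"
        by (rule onorm[OF assms(1)])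
      then have "s * norm (T (T x)) \<le> norm (T x)"
        using mult_left_mono[of "norm (T (T x))" "onorm T * norm (T x)" s] s by simp
      then have "(s * norm (T (T x)))\<^sup>2 \<le> (norm (T x))\<^sup>2"
        using spos by (intro power_mono) auto
      then have "s\<^sup>2 * (s * norm (T (T x)))\<^sup>2 \<le> s\<^sup>2 * (norm (T x))\<^sup>2"
        by (intro mult_left_mono) auto
      then show ?thesis
        by (intro mult_left_mono) (auto simp: power2_eq_square power4_eq_xxxx mult_ac)
    qed
    finally have "(norm x)\<^sup>2 / K\<^sup>2 \<le> (norm x)\<^sup>2 - s\<^sup>2 * (norm (T x))\<^sup>2"
      using K by (simp add: pos_divide_le_eq mult.commute)
    then have "(norm (T x))\<^sup>2 \<le> (1 - 1 / K\<^sup>2) * (norm x)\<^sup>2 / s\<^sup>2"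
      using spos by (simp add: pos_le_divide_eq algebra_simps)
    then have "norm (T x) \<le> sqrt ((1 - 1 / K\<^sup>2) * (norm x)\<^sup>2 / s\<^sup>2)"
      by (rule real_le_rsqrt)
    also have "\<dots> = (onorm T * sqrt (1 - 1 / K\<^sup>2)) * norm x"
      using s by (simp add: real_sqrt_mult real_sqrt_divide)
    finally show ?thesis .
  qed
  then have "onorm T \<le> onorm T * sqrt (1 - 1 / K\<^sup>2)"
    using K s(2) by (intro onorm_bound) auto
  moreover have "sqrt (1 - 1 / K\<^sup>2) < 1"
    using K by simp
  ultimately show False
    using s(2) by (metis mult.right_neutral mult_less_cancel_left_pos not_le)
qed

locale positive_unitary_flow = unitary_flow U for U :: "real \<Rightarrow> 'h::chilbert_space \<Rightarrow> 'h" +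
  assumes resolvent_set_neg: "c > 0 \<Longrightarrow> - of_real c \<in> resolvent_set dom gen"
begin

context
  fixes c :: real
  assumes c: "c > 0"
begin

lemma bij_betw_shifted_gen: "bij_betw (\<lambda>v. gen v - (- of_real c) *\<^sub>C v) dom UNIV"
  using resolvent_set_neg[OF c] by (simp add: resolvent_set_def)

lemma bounded_linear_resolvent: "bounded_linear (resolvent c)"
  using resolvent_set_neg[OF c] by (simp add: resolvent_set_def resolvent_def)

lemma resolvent_dom: "resolvent c x \<in> dom"
  unfolding resolvent_def
  by (rule inv_into_into) (use bij_betw_shifted_gen in \<open>simp add: bij_betw_def\<close>)

lemma gen_resolvent: "gen (resolvent c x) + c *\<^sub>R resolvent c x = x"
  using f_inv_into_f[of x "\<lambda>v. gen v - (- of_real c) *\<^sub>C v" dom] bij_betw_shifted_gen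
  by (simp add: bij_betw_def resolvent_def scaleC_minus_left scaleR_scaleC)

lemma resolvent_gen: "v \<in> dom \<Longrightarrow> resolvent c (gen v + c *\<^sub>R v) = v"
  using inv_into_f_f[of "\<lambda>v. gen v - (- of_real c) *\<^sub>C v" dom v] bij_betw_shifted_gen
  by (simp add: bij_betw_def resolvent_def scaleC_minus_left scaleR_scaleC)

lemma resolvent_self_adjoint: "cinner (resolvent c x) y = cinner x (resolvent c y)"
proof -
  have "cinner (resolvent c x) y = cinner (resolvent c x) (gen (resolvent c y) + c *\<^sub>R resolvent c y)"
    by (simp only: gen_resolvent)
  also have "\<dots> = cinner (gen (resolvent c x) + c *\<^sub>R resolvent c x) (resolvent c y)"
    by (simp add: cinner.add_left cinner.add_right cinner_scaleR_left cinner_scaleR_right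
        gen_symmetric[OF resolvent_dom resolvent_dom] c)
  finally show ?thesis
    by (simp only: gen_resolvent)
qed

lemma U_resolvent: "U t (resolvent c x) = resolvent c (U t x)"
proof -
  have "U t (resolvent c x) = resolvent c (gen (U t (resolvent c x)) + c *\<^sub>R U t (resolvent c x))"
    by (simp add: resolvent_gen U_dom(1)[OF resolvent_dom])
  also have "\<dots> = resolvent c (U t (gen (resolvent c x) + c *\<^sub>R resolvent c x))"
    by (simp add: U_dom(2)[OF resolvent_dom] U_plus U_scaleC scaleR_scaleC)
  finally show ?thesis
    by (simp only: gen_resolvent)
qed

end

text \<open>If the norm of R = \<open>resolvent c\<close> exceeded 1/c, its reciprocal s would be
  below c, and both c - s and c + s would be positive. Then 1 - s R = (A + c - s) R and 1 + s R = (A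
  + c + s) R are both bounded below, which \<open>norm_bound_not_attained\<close> excludes.\<close>

lemma onorm_resolvent_le:
  assumes c: "c > 0"
  shows "onorm (resolvent c) \<le> 1 / c"
proof (rule ccontr)
  let ?R = "resolvent c"
  assume "\<not> ?thesis"
  then have gt: "onorm ?R > 1 / c"
    by simp
  then have pos: "onorm ?R > 0"
    using c by (meson divide_pos_pos less_trans zero_less_one)
  define s where "s = 1 / onorm ?R"
  have s: "0 < s" "s < c"
    using gt pos c by (auto simp: s_def field_simps)
  have key: "norm x \<le> (1 + \<bar>r\<bar> * onorm (resolvent (c - r))) * norm (x - r *\<^sub>R ?R x)"
    if r: "c - r > 0" for r x
  proof -
    let ?w = "x - r *\<^sub>R ?R x"
    have "gen (?R x) + (c - r) *\<^sub>R ?R x = ?w"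
      using gen_resolvent[OF c, of x] by (simp add: algebra_simps)
    then have "?R x = resolvent (c - r) ?w"
      using resolvent_gen[OF r resolvent_dom[OF c], of x] by simp
    then have "norm (?R x) \<le> onorm (resolvent (c - r)) * norm ?w"
      using onorm[OF bounded_linear_resolvent[OF r]] by metis
    then have "\<bar>r\<bar> * norm (?R x) \<le> \<bar>r\<bar> * (onorm (resolvent (c - r)) * norm ?w)"
      by (intro mult_left_mono) auto
    moreover have "norm x \<le> norm ?w + \<bar>r\<bar> * norm (?R x)"
      using norm_triangle_ineq[of ?w "r *\<^sub>R ?R x"] by simp
    ultimately show ?thesis
      by (simp add: algebra_simps)
  qed
  show False
    using key[of s] key[of "- s"] s
    by (intro norm_bound_not_attained[OF bounded_linear_resolvent[OF c] resolvent_self_adjoint[OF c] s_def pos])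
      auto
qed

lemma norm_resolvent_le:
  assumes "c > 0"
  shows "norm (c *\<^sub>R resolvent c x) \<le> norm x"
proof -
  have "norm (resolvent c x) \<le> 1 / c * norm x"
    by (rule order_trans[OF onorm[OF bounded_linear_resolvent] mult_right_mono[OF onorm_resolvent_le]])
      (use assms in auto)
  then show ?thesis
    using assms by (simp add: field_simps)
qed

lemma dom_subspace: "complex_vector.subspace dom"
proof -
  have "dom = range (resolvent 1)"
  proof (intro equalityI subsetI)
    show "v \<in> range (resolvent 1)" if "v \<in> dom" for v
      using resolvent_gen[OF zero_less_one that] by (metis rangeI)
  qed (use resolvent_dom in auto)
  moreover have "gen (a *\<^sub>C v) = a *\<^sub>C gen v \<and> a *\<^sub>C v \<in> dom" if "v \<in> dom" for a v
    using genI[of "a *\<^sub>C v" "a *\<^sub>C gen v"]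
      bounded_linear.has_vector_derivative[OF bounded_linear_scaleC has_derivative_U[OF that], of a]
    by (simp add: U_scaleC scaleC_scaleC mult.commute)
  moreover have "x + y \<in> dom" if "x \<in> dom" "y \<in> dom" for x y
    using has_vector_derivative_add[OF has_derivative_U[OF that(1)] has_derivative_U[OF that(2)]]
    by (auto simp: dom_def U_plus)
  ultimately show ?thesis
    using linear_0[OF bounded_linear.linear[OF bounded_linear_resolvent[of 1]]]
    by (auto simp: complex_vector.subspace_def image_iff)
qed

text \<open>A vector y orthogonal to the domain is orthogonal to R R y for R =
  \<open>resolvent 1\<close>. Self-adjointness gives R y = 0, and then y = (A + 1) R y = 0.\<close>

lemma dom_dense: "closure dom = UNIV"
proof (rule ccontr)
  assume "closure dom \<noteq> UNIV"
  then obtain x where x: "x \<notin> closure dom"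
    by blast
  have sub: "complex_vector.subspace (closure dom)"
    unfolding complex_vector.subspace_def
  proof (intro conjI ballI allI)
    show "0 \<in> closure dom"
      using dom_subspace closure_subset complex_vector.subspace_0 by blast
    show "a + b \<in> closure dom" if ab: "a \<in> closure dom" "b \<in> closure dom" for a b
    proof -
      obtain u where u: "\<And>n. u n \<in> dom" "u \<longlonglongrightarrow> a"
        using ab(1) unfolding closure_sequential by blast
      moreover obtain v where v: "\<And>n. v n \<in> dom" "v \<longlonglongrightarrow> b"
        using ab(2) unfolding closure_sequential by blast
      ultimately have "(\<lambda>n. u n + v n) \<longlonglongrightarrow> a + b" "\<And>n. u n + v n \<in> dom"
        using dom_subspace by (simp_all add: tendsto_add complex_vector.subspace_add)
      then show ?thesis
        unfolding closure_sequential by (intro exI[of _ "\<lambda>n. u n + v n"] conjI allI)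
    qed
    show "r *\<^sub>C a \<in> closure dom" if a: "a \<in> closure dom" for a r
    proof -
      obtain u where u: "\<And>n. u n \<in> dom" "u \<longlonglongrightarrow> a"
        using a unfolding closure_sequential by blast
      then have "(\<lambda>n. r *\<^sub>C u n) \<longlonglongrightarrow> r *\<^sub>C a" "\<And>n. r *\<^sub>C u n \<in> dom"
        using dom_subspace
        by (simp_all add: bounded_linear.tendsto[OF bounded_linear_scaleC] complex_vector.subspace_scale)
      then show ?thesis
        unfolding closure_sequential by (intro exI[of _ "\<lambda>n. r *\<^sub>C u n"] conjI allI)
    qed
  qed
  obtain p where p: "p \<in> closure dom" "\<And>s. s \<in> closure dom \<Longrightarrow> cinner s (x - p) = 0"
    using orthogonal_decomposition[OF closed_closure sub] by blast
  have "cinner (resolvent 1 (resolvent 1 (x - p))) (x - p) = 0"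
    by (rule p(2)[OF subsetD[OF closure_subset resolvent_dom[OF zero_less_one]]])
  then have r0: "resolvent 1 (x - p) = 0"
    by (simp add: resolvent_self_adjoint cinner_self)
  have "gen 0 = 0"
    using U_scaleC[of _ 0] genI(2)[of 0 0] by (simp add: complex_vector.scale_zero_right)
  then have "x - p = 0"
    using gen_resolvent[of 1 "x - p"] r0 by simp
  then show False
    using x p(1) by simp
qed

section \<open>Yosida approximation of the generator\<close>

definition yosida :: "real \<Rightarrow> 'h \<Rightarrow> 'h"
  where "yosida c x = c *\<^sub>R (x - c *\<^sub>R resolvent c x)"

context
  fixes c :: real
  assumes c: "c > 0"
begin

lemma yosida_bounded_linear: "bounded_linear (yosida c)"
  unfolding yosida_def[abs_def]
  by (intro bounded_linear_scaleR_right[THEN bounded_linear_compose] bounded_linear_sub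
      bounded_linear_ident bounded_linear_resolvent c)

lemma yosida_self_adjoint: "cinner (yosida c x) y = cinner x (yosida c y)"
  by (simp add: yosida_def cinner_scaleR_left cinner_scaleR_right cinner.diff_left cinner.diff_right
      resolvent_self_adjoint[OF c])

text \<open>Positivity is exactly the contraction bound \<open>norm_resolvent_le\<close> combined
  with Cauchy-Schwarz. It provides the damping in the upper half plane.\<close>

lemma yosida_nonneg: "\<exists>r\<ge>0. cinner x (yosida c x) = of_real r"
proof -
  have "cnj (cinner x (yosida c x)) = cinner x (yosida c x)"
    using cinner_commute[of x "yosida c x"] yosida_self_adjoint[of x x] by simp
  then obtain r where r: "cinner x (yosida c x) = of_real r"
    by (metis Reals_cases Reals_cnj_iff)
  have "inner x (c *\<^sub>R resolvent c x) \<le> norm x * norm (c *\<^sub>R resolvent c x)"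
    by (rule norm_cauchy_schwarz)
  also have "\<dots> \<le> norm x * norm x"
    using norm_resolvent_le[OF c] by (intro mult_left_mono) auto
  finally have "inner x (yosida c x) \<ge> 0"
    using c by (simp add: yosida_def inner_diff_right power2_norm_eq_inner[symmetric] power2_eq_square)
  then show ?thesis
    using r by (auto simp: inner_eq_Re_cinner)
qed

lemma yosida_norm_le: "norm (yosida c x) \<le> 2 * c * norm x"
  using norm_triangle_ineq4[of x "c *\<^sub>R resolvent c x"] norm_resolvent_le[OF c, of x] c
  by (simp add: yosida_def)

lemma U_yosida: "U t (yosida c x) = yosida c (U t x)"
  by (simp add: yosida_def scaleR_scaleC U_scaleC U_diff U_resolvent[OF c])

lemma yosida_dom: "v \<in> dom \<Longrightarrow> yosida c v = c *\<^sub>R resolvent c (gen v)"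
proof -
  assume v: "v \<in> dom"
  interpret R: bounded_linear "resolvent c"
    by (rule bounded_linear_resolvent[OF c])
  show ?thesis
    using arg_cong[OF resolvent_gen[OF c v], of "(*\<^sub>R) c"]
    by (simp add: yosida_def R.add R.scaleR algebra_simps)
qed

end

text \<open>On the domain the approximant is \<open>c *\<^sub>R resolvent c\<close> applied to
  \<open>gen v\<close>, so it suffices that these contractions tend strongly to the identity. The
  defect \<open>J n\<close> is bounded by 2 and of order 1/n on the dense domain.\<close>

lemma yosida_tendsto:
  assumes "v \<in> dom"
  shows "(\<lambda>n. yosida (real (Suc n)) v) \<longlonglongrightarrow> gen v"
proof -
  define J where "J n x = real (Suc n) *\<^sub>R resolvent (real (Suc n)) x - x" for n x
  have Jb: "norm (J n x) \<le> 2 * norm x" for n x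
    using norm_triangle_ineq4[of "real (Suc n) *\<^sub>R resolvent (real (Suc n)) x" x]
      norm_resolvent_le[of "real (Suc n)" x] by (simp add: J_def del: of_nat_Suc)
  have Jd: "norm (J n x) \<le> norm (gen x) * (1 / real (Suc n))" if "x \<in> dom" for n x
  proof -
    interpret R: bounded_linear "resolvent (real (Suc n))"
      by (rule bounded_linear_resolvent) simp
    have "J n x = - resolvent (real (Suc n)) (gen x)"
      using resolvent_gen[of "real (Suc n)" x] that
      by (simp add: J_def R.add R.scaleR algebra_simps del: of_nat_Suc)
    then have "real (Suc n) * norm (J n x) \<le> norm (gen x)"
      using norm_resolvent_le[of "real (Suc n)" "gen x"] by (simp del: of_nat_Suc)
    then show ?thesis
      by (simp add: field_simps)
  qed
  have Jdiff: "J n (x - y) = J n x - J n y" for n x y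
    using bounded_linear.linear[OF bounded_linear_resolvent[of "real (Suc n)"]]
    by (simp add: J_def linear_diff algebra_simps del: of_nat_Suc)
  have "(\<lambda>n. J n x) \<longlonglongrightarrow> 0" for x
  proof (rule LIMSEQ_I)
    fix e :: real assume e: "0 < e"
    \<comment> \<open>\<open>J n\<close> at most doubles norms, so a quarter of \<open>e\<close>
      here leaves half of it for \<open>y\<close>.\<close>
    obtain y where y: "y \<in> dom" "norm (x - y) < e / 4"
      using dom_dense closure_approachable[of x dom] e
      by (metis UNIV_I dist_norm norm_minus_commute zero_less_divide_iff zero_less_numeral)
    obtain N where N: "2 * norm (gen y) / e < real N"
      using reals_Archimedean2 by blast
    show "\<exists>N. \<forall>n\<ge>N. norm (J n x - 0) < e"
    proof (intro exI[of _ N] allI impI)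
      fix n assume "n \<ge> N"
      then have "2 * norm (gen y) / e < real (Suc n)"
        using N by simp
      then have "norm (gen y) * (1 / real (Suc n)) < e / 2"
        using e by (simp add: field_simps)
      moreover have "norm (J n x) \<le> norm (J n (x - y)) + norm (J n y)"
        using norm_triangle_ineq[of "J n (x - y)" "J n y"] by (simp add: Jdiff)
      ultimately show "norm (J n x - 0) < e"
        using Jb[of n "x - y"] Jd[OF y(1), of n] y(2) by (simp only: diff_zero)
    qed
  qed
  then have "(\<lambda>n. J n (gen v) + gen v) \<longlonglongrightarrow> 0 + gen v"
    by (intro tendsto_intros)
  then show ?thesis
    using assms by (simp add: J_def yosida_dom)
qed

section \<open>Polynomial approximation of the flow\<close>

definition euler_step :: "real \<Rightarrow> nat \<Rightarrow> complex \<Rightarrow> 'h \<Rightarrow> 'h"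
  where "euler_step c n z x = x + (\<i> * z / of_nat n) *\<^sub>C yosida c x"

context
  fixes c :: real and n :: nat and R :: real
  assumes c: "c > 0" and R: "R > 0" and n: "n > 0" "(2 * c * R)\<^sup>2 \<le> real n"
begin

text \<open>For \<open>Im z \<ge> 0\<close> positivity makes the cross term a loss, so only the
  quadratic term can increase the norm. By \<open>yosida_norm_le\<close> the condition
  \<open>(2 * c * R)\<^sup>2 \<le> real n\<close> reduces that term to 1/n, and \<open>n\<close>
  steps cost a factor independent of \<open>c\<close> and \<open>R\<close>.\<close>

lemma norm_euler_step_le:
  assumes "Im z \<ge> 0" "norm z \<le> R"
  shows "norm (euler_step c n z x) \<le> sqrt (1 + 1 / n) * norm x"
proof -
  obtain r where r: "r \<ge> 0" "cinner x (yosida c x) = of_real r"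
    using yosida_nonneg[OF c] by blast
  have "Re (\<i> * z / of_nat n * cinner x (yosida c x)) = - (Im z * r / n)"
    by (simp add: r(2))
  then have "(norm (euler_step c n z x))\<^sup>2
      \<le> (norm x)\<^sup>2 + (norm z / n)\<^sup>2 * (norm (yosida c x))\<^sup>2"
    using r(1) assms(1) by (simp add: euler_step_def norm_add_scaleC_sq norm_divide norm_mult)
  also have "(norm z / n)\<^sup>2 * (norm (yosida c x))\<^sup>2 \<le> (R / n)\<^sup>2 * (2 * c * norm x)\<^sup>2"
    using assms(2) yosida_norm_le[OF c] by (intro mult_mono power_mono divide_right_mono) auto
  also have "\<dots> = (2 * c * R)\<^sup>2 / (real n)\<^sup>2 * (norm x)\<^sup>2"
    by (simp add: power_mult_distrib power_divide)
  also have "\<dots> \<le> real n / (real n)\<^sup>2 * (norm x)\<^sup>2"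
    using n by (intro mult_right_mono divide_right_mono) auto
  also have "real n / (real n)\<^sup>2 = 1 / n"
    by (simp add: power2_eq_square)
  finally have "(norm (euler_step c n z x))\<^sup>2 \<le> (1 + 1 / n) * (norm x)\<^sup>2"
    by (simp add: algebra_simps)
  then have "norm (euler_step c n z x) \<le> sqrt ((1 + 1 / n) * (norm x)\<^sup>2)"
    by (rule real_le_rsqrt)
  then show ?thesis
    by (simp add: real_sqrt_mult)
qed

lemma euler_factor_le: "k \<le> n \<Longrightarrow> sqrt (1 + 1 / n) ^ k \<le> 2"
proof -
  assume "k \<le> n"
  then have "(1 + 1 / real n) ^ k \<le> (1 + 1 / real n) ^ n"
    by (intro power_increasing) auto
  also have "\<dots> \<le> exp (1 / real n) ^ n"
    using n(1) exp_ge_add_one_self[of "1 / real n"] by (intro power_mono) auto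
  also have "\<dots> = exp 1"
    using n(1) by (simp add: exp_of_nat_mult[symmetric])
  also have "\<dots> \<le> 2\<^sup>2"
    using exp_le by simp
  finally have "sqrt ((1 + 1 / real n) ^ k) \<le> 2"
    by (intro real_le_lsqrt) auto
  then show ?thesis
    by (simp add: real_sqrt_power)
qed

lemma norm_euler_power_le:
  assumes "Im z \<ge> 0" "norm z \<le> R" "k \<le> n"
  shows "norm ((euler_step c n z ^^ k) x) \<le> 2 * norm x"
proof -
  have "norm ((euler_step c n z ^^ j) x) \<le> sqrt (1 + 1 / n) ^ j * norm x" for j
  proof (induction j)
    case (Suc j)
    show ?case
      using norm_euler_step_le[OF assms(1,2), of "(euler_step c n z ^^ j) x"]
        mult_left_mono[OF Suc, of "sqrt (1 + 1 / n)"] by (simp add: mult.assoc)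
  qed simp
  also have "sqrt (1 + 1 / n) ^ k * norm x \<le> 2 * norm x"
    using euler_factor_le[OF assms(3)] by (rule mult_right_mono) simp
  finally show ?thesis .
qed

lemma holomorphic_euler: "(\<lambda>z. cinner x ((euler_step c n z ^^ k) v)) holomorphic_on UNIV"
proof (induction k arbitrary: x)
  case (Suc k)
  have "(\<lambda>z. cinner x ((euler_step c n z ^^ Suc k) v)) = (\<lambda>z. cinner x ((euler_step c n z ^^ k) v)
      + \<i> * z / of_nat n * cinner (yosida c x) ((euler_step c n z ^^ k) v))"
    by (simp add: euler_step_def[of _ _ _ "(_ ^^ _) _"] cinner_add_right cinner_scaleC_right
        yosida_self_adjoint[OF c])
  moreover have "\<dots> holomorphic_on UNIV"
    using n(1) by (intro holomorphic_intros Suc) auto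
  ultimately show ?case
    by simp
qed simp

text \<open>Telescoping over the steps. Since a step commutes with the flow, every local error is a
  translate of the one at \<open>v\<close>, so a single \<delta> controls all of them.\<close>

lemma euler_approx:
  fixes \<delta> :: real
  assumes "\<bar>t\<bar> \<le> R"
    and \<delta>: "norm (euler_step c n (of_real t) v - U (t / n) v) \<le> \<delta>"
  shows "norm ((euler_step c n (of_real t) ^^ n) v - U t v) \<le> 2 * n * \<delta>"
proof -
  let ?S = "euler_step c n (of_real t)" and ?r = "sqrt (1 + 1 / n)"
  interpret Y: bounded_linear "yosida c"
    by (rule yosida_bounded_linear[OF c])
  have Sd: "?S (x - y) = ?S x - ?S y" for x y
    by (simp add: euler_step_def Y.diff complex_vector.scale_right_diff_distrib)
  have SU: "?S (U s x) = U s (?S x)" for s x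
    by (simp add: euler_step_def U_plus U_scaleC U_yosida[OF c])
  have \<delta>0: "\<delta> \<ge> 0"
    using \<delta> norm_ge_zero order_trans by blast
  have "norm ((?S ^^ k) v - U (k * (t / n)) v) \<le> k * ?r ^ k * \<delta>" for k
  proof (induction k)
    case (Suc k)
    have r1: "?r ^ Suc k \<ge> 1"
      by (rule one_le_power) simp
    have "(?S ^^ Suc k) v - U (Suc k * (t / n)) v
        = ?S ((?S ^^ k) v - U (k * (t / n)) v) + U (k * (t / n)) (?S v - U (t / n) v)"
      by (simp add: Sd SU U_diff U_add[symmetric] algebra_simps add_divide_distrib)
    then have "norm ((?S ^^ Suc k) v - U (Suc k * (t / n)) v)
        \<le> norm (?S ((?S ^^ k) v - U (k * (t / n)) v)) + norm (?S v - U (t / n) v)"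
      using norm_triangle_ineq U_norm by metis
    also have "\<dots> \<le> ?r * (k * ?r ^ k * \<delta>) + \<delta>"
    proof (intro add_mono \<delta>)
      have "norm (?S ((?S ^^ k) v - U (k * (t / n)) v)) \<le> ?r * norm ((?S ^^ k) v - U (k * (t / n)) v)"
        using assms(1) by (intro norm_euler_step_le) auto
      also have "\<dots> \<le> ?r * (k * ?r ^ k * \<delta>)"
        by (intro mult_left_mono Suc) auto
      finally show "norm (?S ((?S ^^ k) v - U (k * (t / n)) v)) \<le> ?r * (k * ?r ^ k * \<delta>)" .
    qed
    also have "\<dots> \<le> ?r * (k * ?r ^ k * \<delta>) + ?r ^ Suc k * \<delta>"
      using r1 mult_right_mono[of 1 "?r ^ Suc k" \<delta>] \<delta>0 by simp
    also have "\<dots> = Suc k * ?r ^ Suc k * \<delta>"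
      by (simp add: algebra_simps)
    finally show ?case .
  qed (simp add: U_0)
  from this[of n] have "norm ((?S ^^ n) v - U t v) \<le> n * ?r ^ n * \<delta>"
    using n(1) by simp
  also have "\<dots> \<le> real n * 2 * \<delta>"
    using euler_factor_le[of n] \<delta>0 by (intro mult_right_mono mult_left_mono) auto
  finally show ?thesis
    by simp
qed

end

lemma euler_uniform:
  assumes v: "v \<in> dom" and R: "R > 0" and e: "e > 0"
  shows "\<exists>c>0. \<exists>n>0. (2 * c * R)\<^sup>2 \<le> real n \<and>
    (\<forall>t. \<bar>t\<bar> \<le> R \<longrightarrow> norm ((euler_step c n (of_real t) ^^ n) v - U t v) \<le> e)"
proof -
  \<comment> \<open>Each step has two errors of size \<open>e' * \<bar>t / n\<bar>\<close>, and
    \<open>euler_approx\<close> multiplies by \<open>2 * n\<close>: in total at most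
    \<open>4 * e' * R\<close>.\<close>
  define e' where "e' = e / (4 * R)"
  have e': "e' > 0"
    using e R by (simp add: e'_def)
  obtain m where "norm (yosida (real (Suc m)) v - gen v) < e'"
    using LIMSEQ_D[OF yosida_tendsto[OF v] e'] by blast
  then obtain c where c: "c > 0" "norm (yosida c v - gen v) \<le> e'"
    by (metis less_imp_le of_nat_0_less_iff zero_less_Suc)
  have "((\<lambda>t. U t v) has_derivative (\<lambda>t. t *\<^sub>R \<i> *\<^sub>C gen v)) (at 0)"
    using has_derivative_U[OF v] by (simp add: has_vector_derivative_def)
  then obtain d where d: "d > 0" "\<And>t. \<bar>t\<bar> < d \<Longrightarrow> norm (U t v - v - t *\<^sub>R \<i> *\<^sub>C gen v) \<le> e' * \<bar>t\<bar>"
    using e' unfolding has_derivative_at_alt by (auto simp: U_0)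
  obtain n :: nat where n: "n > R / d" "n \<ge> (2 * c * R)\<^sup>2"
  proof -
    obtain n1 n2 :: nat where "n1 > R / d" "n2 \<ge> (2 * c * R)\<^sup>2"
      using reals_Archimedean2 real_arch_simple by meson
    then show ?thesis
      by (intro that[of "max n1 n2"]) auto
  qed
  have "R / d > 0"
    using R d(1) by simp
  then have n0: "n > 0"
    using n(1) by (metis less_trans of_nat_0_less_iff)
  show ?thesis
  proof (intro exI[of _ c] exI[of _ n] conjI allI impI c(1) n0 n(2))
    fix t assume t: "\<bar>t\<bar> \<le> R"
    have "\<bar>t / n\<bar> < d"
    proof -
      have "R < real n * d"
        using n(1) d(1) by (simp add: pos_divide_less_eq)
      then show ?thesis
        using t n0 by (simp add: abs_divide pos_divide_less_eq mult.commute)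
    qed
    then have "norm (U (t / n) v - v - (t / n) *\<^sub>R \<i> *\<^sub>C gen v) \<le> e' * \<bar>t / n\<bar>"
      by (rule d(2))
    moreover have "euler_step c n (of_real t) v - U (t / n) v
        = (t / n) *\<^sub>R \<i> *\<^sub>C (yosida c v - gen v) - (U (t / n) v - v - (t / n) *\<^sub>R \<i> *\<^sub>C gen v)"
      by (simp add: euler_step_def scaleR_scaleC scaleC_scaleC
          complex_vector.scale_right_diff_distrib mult.commute)
    then have "norm (euler_step c n (of_real t) v - U (t / n) v) \<le> norm ((t / n) *\<^sub>R \<i> *\<^sub>C (yosida c v - gen v))
        + norm (U (t / n) v - v - (t / n) *\<^sub>R \<i> *\<^sub>C gen v)"
      using norm_triangle_ineq4 by metis
    moreover have "norm ((t / n) *\<^sub>R \<i> *\<^sub>C (yosida c v - gen v)) \<le> e' * \<bar>t / n\<bar>"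
      using mult_right_mono[OF c(2), of "\<bar>t / n\<bar>"] by (simp add: norm_scaleC mult.commute)
    ultimately have \<delta>: "norm (euler_step c n (of_real t) v - U (t / n) v) \<le> 2 * e' * \<bar>t / n\<bar>"
      by linarith
    have "norm ((euler_step c n (of_real t) ^^ n) v - U t v) \<le> 2 * n * (2 * e' * \<bar>t / n\<bar>)"
      by (rule euler_approx[OF c(1) R n0 n(2) t \<delta>])
    also have "\<dots> = 4 * e' * \<bar>t\<bar>"
      using n0 by (simp add: abs_divide)
    also have "\<dots> \<le> 4 * e' * R"
      using t e' by (intro mult_left_mono) auto
    also have "\<dots> = e"
      using R by (simp add: e'_def)
    finally show "norm ((euler_step c n (of_real t) ^^ n) v - U t v) \<le> e" .
  qed
qed

text \<open>On the domain the Euler polynomials are the entire approximants, bounded by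
  \<open>norm x * (2 * norm v)\<close> for every radius. For general \<open>y\<close> the flow is
  moved to the left slot, which exhibits a bounded functional of \<open>y\<close> vanishing on a
  dense set.\<close>

lemma upper_test_integral_flow:
  assumes g: "upper_test g"
  shows "(LINT t|lborel. g (of_real t) * cinner x (U t y)) = 0"
proof -
  have cont: "continuous_on UNIV (\<lambda>t. cinner x (U t v))" for v
    by (intro cinner.continuous_on continuous_on_const U_continuous)
  have bnd: "norm (cinner x (U t v)) \<le> norm x * norm v" for t v
    using norm_cinner_le[of x "U t v"] by simp
  have on_dom: "(LINT t|lborel. g (of_real t) * cinner x (U t v)) = 0" if v: "v \<in> dom" for v
  proof (rule upper_test_integral_eq_0[OF g cont bnd])
    fix R e :: real assume R: "R > 0" and e: "e > 0"
    have "e / (norm x + 1) > 0"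
      using e by (simp add: add_nonneg_pos)
    from euler_uniform[OF v R this] obtain c n where cn: "c > 0" "n > 0" "(2 * c * R)\<^sup>2 \<le> real n"
      "\<And>t. \<bar>t\<bar> \<le> R \<Longrightarrow> norm ((euler_step c n (of_real t) ^^ n) v - U t v) \<le> e / (norm x + 1)"
      by blast
    let ?p = "\<lambda>z. cinner x ((euler_step c n z ^^ n) v)"
    have "norm (?p z) \<le> norm x * (2 * norm v)" if "Im z \<ge> 0" "norm z \<le> R" for z
      using norm_cinner_le[of x "(euler_step c n z ^^ n) v"]
        mult_left_mono[OF norm_euler_power_le[OF cn(1) R cn(2,3) that order_refl, of v], of "norm x"]
      by simp
    moreover have "norm (?p (of_real t) - cinner x (U t v)) \<le> e" if "\<bar>t\<bar> \<le> R" for t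
    proof -
      have "norm (?p (of_real t) - cinner x (U t v))
          \<le> norm x * norm ((euler_step c n (of_real t) ^^ n) v - U t v)"
        unfolding cinner.diff_right[symmetric] by (rule norm_cinner_le)
      also have "\<dots> \<le> (norm x + 1) * (e / (norm x + 1))"
        using e cn(4)[OF that] by (intro mult_mono) auto
      also have "\<dots> = e"
        by (simp add: add_nonneg_eq_0_iff)
      finally show ?thesis .
    qed
    ultimately show "\<exists>p. p holomorphic_on UNIV \<and>
        (\<forall>z. Im z \<ge> 0 \<and> norm z \<le> R \<longrightarrow> norm (p z) \<le> norm x * (2 * norm v)) \<and>
        (\<forall>t. \<bar>t\<bar> \<le> R \<longrightarrow> norm (p (of_real t) - cinner x (U t v)) \<le> e)"
      using holomorphic_euler[OF cn(1) R cn(2,3)] by blast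
  qed
  have int: "integrable lborel (\<lambda>t. g (of_real t))"
    using upper_test_integrable[OF g, of "\<lambda>_. 1" 1] by simp
  have bl: "bounded_linear (\<lambda>v. LINT t|lborel. g (of_real t) * cinner (U (- t) x) v)"
    by (rule bounded_linear_integral_cinner_right[OF int, of _ "norm x"])
      (auto intro!: continuous_on_U continuous_intros)
  have "closed {v. (LINT t|lborel. g (of_real t) * cinner (U (- t) x) v) = 0}"
    by (intro closed_Collect_eq linear_continuous_on[OF bl] continuous_on_const)
  moreover have "dom \<subseteq> {v. (LINT t|lborel. g (of_real t) * cinner (U (- t) x) v) = 0}"
    using on_dom by (auto simp: U_adjoint)
  ultimately have "closure dom \<subseteq> {v. (LINT t|lborel. g (of_real t) * cinner (U (- t) x) v) = 0}"
    by (rule closure_minimal[rotated])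
  then show ?thesis
    by (auto simp: dom_dense U_adjoint)
qed

end

section \<open>Spectral bounds\<close>

lemma integrable_phase_upper_test:
  assumes "upper_test g"
  shows "integrable lborel (\<lambda>t. exp (\<i> * of_real (a * t)) * g (of_real t))"
proof -
  have "integrable lborel (\<lambda>t. g (of_real t) * exp (\<i> * of_real (a * t)))"
    by (rule upper_test_integrable[OF assms, of _ 1]) (auto intro!: continuous_intros)
  then show ?thesis
    by (simp only: mult.commute)
qed

lemma continuous_phase_upper_test:
  assumes "upper_test g"
  shows "continuous_on UNIV (\<lambda>t. exp (\<i> * of_real (a * t)) * g (of_real t))"
  by (intro continuous_intros upper_test_continuous assms)

context unitary_flow
begin

definition energy_above :: "real \<Rightarrow> bool"
  where "energy_above \<mu> \<longleftrightarrow> (\<forall>g x y. upper_test g \<longrightarrow>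
    (LINT t|lborel. (exp (\<i> * of_real (- \<mu> * t)) * g (of_real t)) * cinner x (U t y)) = 0)"

text \<open>Scaling the Fejer function by the energy bound itself absorbs the phase: the test
  becomes a fixed kernel \<kappa> rescaled ever more narrowly around 0, where it picks out
  \<open>cinner x x\<close>.\<close>

lemma energy_above_unbounded:
  assumes "\<Lambda> > 0" "\<And>n. energy_above (real n * \<Lambda>)"
  shows "x = (0::'h)"
proof -
  define h where "h t = cinner x (U t x)" for t
  define \<kappa> where "\<kappa> t = exp (- \<i> * of_real t) * Fejer (of_real t)" for t :: real
  define a where "a n = 1 / (real (Suc n) * \<Lambda>)" for n
  have zero: "(LINT s|lborel. \<kappa> s * h (0 + a n * s)) = 0" for n
  proof -
    let ?r = "real (Suc n) * \<Lambda>"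
    have r: "?r > 0"
      using assms(1) by simp
    have "(LINT t|lborel. (exp (\<i> * of_real (- ?r * t)) * Fejer (of_real ?r * of_real t)) * h t) = 0"
      using assms(2)[of "Suc n"] upper_test_scale[OF upper_test_Fejer r]
      unfolding energy_above_def h_def by blast
    then have "(LINT t|lborel. \<kappa> (?r * t) * h t) = 0"
      by (simp add: \<kappa>_def del: of_nat_Suc)
    moreover have "(LINT t|lborel. \<kappa> (?r * t) * h t) = a n *\<^sub>R (LINT s|lborel. \<kappa> (?r * (0 + a n * s)) * h (0 + a n * s))"
      using r by (subst lborel_integral_real_affine[of "a n" _ 0]) (auto simp: a_def simp del: of_nat_Suc)
    moreover have "?r * (0 + a n * s) = s" for s
      using assms(1) by (simp add: a_def del: of_nat_Suc)
    moreover have "a n \<noteq> 0"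
      using assms(1) by (simp add: a_def del: of_nat_Suc)
    ultimately show ?thesis
      by (simp only: scaleR_eq_0_iff simp_thms)
  qed
  have "(\<lambda>n. LINT s|lborel. \<kappa> s * h (0 + a n * s)) \<longlonglongrightarrow> (LINT s|lborel. \<kappa> s) * h 0"
  proof (rule approximate_identity)
    show "integrable lborel \<kappa>"
      using integrable_phase_upper_test[OF upper_test_Fejer, of "- 1"] by (simp add: \<kappa>_def[abs_def])
    show "continuous_on UNIV h"
      unfolding h_def by (intro cinner.continuous_on continuous_on_const U_continuous)
    show "norm (h t) \<le> norm x * norm x" for t
      using norm_cinner_le[of x "U t x"] by (simp add: h_def)
    have "(\<lambda>n. 1 / \<Lambda> * (1 / real (Suc n))) \<longlonglongrightarrow> 0"
      using tendsto_mult_left[OF LIMSEQ_inverse_real_of_nat[unfolded inverse_eq_divide], of "1 / \<Lambda>"]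
      by (simp only: mult_zero_right)
    then show "a \<longlonglongrightarrow> 0"
      by (simp add: a_def[abs_def] mult.commute)
  qed
  then have "(LINT s|lborel. \<kappa> s) * h 0 = 0"
    unfolding zero using LIMSEQ_unique tendsto_const by blast
  then have "h 0 = 0"
    using Fejer_integral_nonzero by (simp add: \<kappa>_def)
  then show ?thesis
    by (simp add: h_def U_0 cinner_self)
qed

end

section \<open>Operators that raise the energy\<close>

locale flow_with_operator = unitary_flow U for U :: "real \<Rightarrow> 'h::chilbert_space \<Rightarrow> 'h" +
  fixes p :: "'h \<Rightarrow> 'h"
  assumes p_bounded_linear: "bounded_linear p"
    and p_self_adjoint: "cinner (p x) y = cinner x (p y)"
begin

definition conjugate :: "real \<Rightarrow> 'h \<Rightarrow> 'h"
  where "conjugate t x = U t (p (U (- t) x))"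

lemma conjugate_self_adjoint: "cinner (conjugate t x) y = cinner x (conjugate t y)"
  by (simp add: conjugate_def U_adjoint p_self_adjoint)

lemma continuous_on_conjugate:
  assumes "continuous_on S f"
  shows "continuous_on S (\<lambda>x. conjugate (f x) y)"
  unfolding conjugate_def
  by (intro continuous_on_U assms bounded_linear.continuous_on[OF p_bounded_linear] continuous_intros)

lemma norm_conjugate_le: "norm (conjugate t x) \<le> onorm p * norm x"
  using onorm[OF p_bounded_linear, of "U (- t) x"] by (simp add: conjugate_def)

text \<open>The common kernel of the adjoints of the operators
  \<open>\<integral> exp (\<i> \<Lambda> t) q(t) \<alpha>\<^bsub>r - t\<^esub>(p) dt\<close>, which raise the energy by at least \<open>\<Lambda>\<close>;
  here \<open>\<alpha>\<^bsub>t\<^esub>(p) = U\<^bsub>t\<^esub> p U\<^bsub>-t\<^esub>\<close>.\<close>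

definition raising_kernel :: "real \<Rightarrow> (complex \<Rightarrow> complex) \<Rightarrow> 'h set"
  where "raising_kernel \<Lambda> q = {\<eta>. \<forall>r \<xi>.
    (LINT t|lborel. (exp (\<i> * of_real (\<Lambda> * t)) * q (of_real t)) * cinner \<eta> (conjugate (r - t) \<xi>)) = 0}"

lemma raising_kernel_closed_subspace:
  assumes "upper_test q"
  shows "closed (raising_kernel \<Lambda> q)" "complex_vector.subspace (raising_kernel \<Lambda> q)"
proof -
  have bl: "bounded_linear (\<lambda>\<eta>. LINT t|lborel.
      (exp (\<i> * of_real (\<Lambda> * t)) * q (of_real t)) * cinner \<eta> (conjugate (r - t) \<xi>))" for r \<xi>
    by (rule bounded_linear_integral_cinner_left[OF integrable_phase_upper_test[OF assms] _ norm_conjugate_le])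
      (intro continuous_on_conjugate continuous_intros)
  show "closed (raising_kernel \<Lambda> q)"
    unfolding raising_kernel_def
    by (intro closed_Collect_all closed_Collect_eq linear_continuous_on[OF bl] continuous_on_const)
  show "complex_vector.subspace (raising_kernel \<Lambda> q)"
    unfolding complex_vector.subspace_def raising_kernel_def
    using linear_add[OF bounded_linear.linear[OF bl]]
    by (auto simp: cinner.zero_left cinner_scaleC_left mult.left_commute[of _ "cnj _"])
qed

lemma raising_kernel_invariant:
  assumes "\<And>x y. cinner (V x) y = cinner x (V' y)"
    and "\<And>t x. V' (conjugate t x) = conjugate t (V' x)"
  shows "V ` raising_kernel \<Lambda> q \<subseteq> raising_kernel \<Lambda> q"
  by (auto simp: raising_kernel_def assms)

text \<open>A time shift is absorbed into \<open>r\<close> and \<xi>; this is the purpose of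
  quantifying over \<open>r\<close>.\<close>

lemma raising_kernel_U: "U s ` raising_kernel \<Lambda> q \<subseteq> raising_kernel \<Lambda> q"
proof -
  have shift: "U (- s) (conjugate t x) = conjugate (t - s) (U (- s) x)" for t x
    by (simp add: conjugate_def U_add[symmetric])
  have "r - t - s = (r - s) - t" for r t :: real
    by simp
  then show ?thesis
    by (auto simp only: raising_kernel_def U_adjoint shift image_subset_iff mem_Collect_eq)
qed

text \<open>The functional that tests the level \<mu> + \<Lambda> is represented by a vector
  \<open>v\<close>. Paired with a raised vector it reduces to a test at level \<mu>, because raising
  supplies the missing phase; hence \<open>v\<close> lies in the kernel.\<close>

lemma energy_above_raise:
  assumes \<mu>: "energy_above \<mu>" and q: "upper_test q" and triv: "raising_kernel \<Lambda> q = {0}"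
  shows "energy_above (\<mu> + \<Lambda>)"
  unfolding energy_above_def
proof (intro allI impI)
  fix g x y assume g: "upper_test g"
  define f where "f s = exp (\<i> * of_real (- (\<mu> + \<Lambda>) * s)) * g (of_real s)" for s :: real
  define a where "a t = exp (\<i> * of_real (\<Lambda> * t)) * q (of_real t)" for t :: real
  have f: "integrable lborel f" "continuous_on UNIV f"
    unfolding f_def by (rule integrable_phase_upper_test[OF g] continuous_phase_upper_test[OF g])+
  have a: "integrable lborel a" "continuous_on UNIV a"
    unfolding a_def by (rule integrable_phase_upper_test[OF q] continuous_phase_upper_test[OF q])+
  have bl: "bounded_linear (\<lambda>\<eta>. LINT s|lborel. f s * cinner x (U s \<eta>))"
  proof -
    have "bounded_linear (\<lambda>\<eta>. LINT s|lborel. f s * cinner (U (- s) x) \<eta>)"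
      by (rule bounded_linear_integral_cinner_right[OF f(1), of _ "norm x"])
        (auto intro!: continuous_on_U continuous_intros)
    then show ?thesis
      by (simp add: U_adjoint)
  qed
  obtain v where v: "\<And>\<eta>. (LINT s|lborel. f s * cinner x (U s \<eta>)) = cinner v \<eta>"
    using riesz_representation[OF bl] by (auto simp: U_scaleC cinner_scaleC_right mult.left_commute[of "f _"])
  have "v \<in> raising_kernel \<Lambda> q"
    unfolding raising_kernel_def mem_Collect_eq a_def[symmetric]
  proof (intro allI)
    fix r \<xi>
    \<comment> \<open>After substituting \<open>s = u + (t - r)\<close> the operator
      \<open>U u\<close> in front of \<open>p\<close> is free of \<open>t\<close>, so for fixed
      \<open>u\<close> the inner integral is a matrix coefficient of the flow in
      \<open>t\<close>.\<close>
    define H where "H t u = a t * f (u + (t - r)) * cinner x (U u (p (U (t - r) \<xi>)))" for t u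
    have shift: "(LINT s|lborel. f s * cinner x (U s (conjugate (r - t) \<xi>)))
        = (LINT u|lborel. f (u + (t - r)) * cinner x (U u (p (U (t - r) \<xi>))))" for t
    proof -
      have "U s (conjugate (r - t) \<xi>) = U (s + (r - t)) (p (U (t - r) \<xi>))" for s
        by (simp add: conjugate_def U_add[symmetric])
      then show ?thesis
        by (subst lborel_integral_real_affine[of 1 _ "t - r"]) (auto simp: add.commute add_diff_eq)
    qed
    have "(LINT t|lborel. a t * cinner v (conjugate (r - t) \<xi>)) = (LINT t|lborel. LINT u|lborel. H t u)"
      unfolding v[symmetric] shift H_def mult.assoc by simp
    also have "\<dots> = (LINT u|lborel. LINT t|lborel. H t u)"
    proof (rule lborel_pair.Fubini_integral[symmetric])
      \<comment> \<open>The matrix coefficient is bounded uniformly in both times; by translation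
        invariance the dominating function then has an iterated integral that factors.\<close>
      let ?K = "norm x * (onorm p * norm \<xi>)"
      have fint: "integrable lborel (\<lambda>u. norm (f (u + c)))"
        and fval: "(LINT u|lborel. norm (f (u + c))) = (LINT u|lborel. norm (f u))" for c
        using lborel_integrable_real_affine[OF integrable_norm[OF f(1)], of 1 c]
          lborel_integral_real_affine[of 1 "\<lambda>u. norm (f u)" c] by (simp_all add: add.commute)
      have H_cont: "continuous_on UNIV (\<lambda>z. H (fst z) (snd z))"
        unfolding H_def
        by (intro continuous_intros cinner.continuous_on continuous_on_U
            bounded_linear.continuous_on[OF p_bounded_linear]
            continuous_on_compose2[OF a(2)] continuous_on_compose2[OF f(2)]) auto
      have G_cont: "continuous_on UNIV (\<lambda>z. norm (a (fst z)) * norm (f (snd z + (fst z - r))) * ?K)"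
        by (intro continuous_intros continuous_on_compose2[OF a(2)] continuous_on_compose2[OF f(2)]) auto
      have "integrable (lborel \<Otimes>\<^sub>M lborel) (\<lambda>z. norm (a (fst z)) * norm (f (snd z + (fst z - r))) * ?K)"
      proof (rule lborel_pair.Fubini_integrable)
        show "(\<lambda>z. norm (a (fst z)) * norm (f (snd z + (fst z - r))) * ?K) \<in> borel_measurable (lborel \<Otimes>\<^sub>M lborel)"
          using G_cont by (simp add: lborel_prod borel_measurable_continuous_onI)
        show "integrable lborel (\<lambda>t. LINT u|lborel. norm (norm (a (fst (t, u))) * norm (f (snd (t, u) + (fst (t, u) - r))) * ?K))"
          using a(1) by (simp add: abs_mult fval)
        show "AE t in lborel. integrable lborel (\<lambda>u. norm (a (fst (t, u))) * norm (f (snd (t, u) + (fst (t, u) - r))) * ?K)"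
          using fint by simp
      qed
      then show "integrable (lborel \<Otimes>\<^sub>M lborel) (case_prod H)"
      proof (rule Bochner_Integration.integrable_bound)
        show "case_prod H \<in> borel_measurable (lborel \<Otimes>\<^sub>M lborel)"
          using H_cont by (simp add: lborel_prod borel_measurable_continuous_onI case_prod_beta')
        have K: "norm (cinner x (U u (p (U s \<xi>)))) \<le> ?K" for u s
          using norm_cinner_le[of x "U u (p (U s \<xi>))"]
            mult_left_mono[OF onorm[OF p_bounded_linear, of "U s \<xi>"], of "norm x"] by simp
        have "norm (H t u) \<le> norm (a t) * norm (f (u + (t - r))) * ?K" for t u
          unfolding H_def norm_mult by (intro mult_left_mono K mult_nonneg_nonneg norm_ge_zero)
        then show "AE z in lborel \<Otimes>\<^sub>M lborel. norm (case_prod H z)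
            \<le> norm (norm (a (fst z)) * norm (f (snd z + (fst z - r))) * ?K)"
          by (intro AE_I2) (auto simp: case_prod_beta' intro: order_trans[OF _ abs_ge_self])
      qed
    qed
    also have "\<dots> = 0"
    proof -
      have "(LINT t|lborel. H t u) = 0" for u
      proof -
        \<comment> \<open>The \<Lambda>-phases cancel in \<open>t\<close>, leaving the phase of
          level \<mu> and this constant; \<open>q\<close> and the translate of \<open>g\<close> form
          a single test function.\<close>
        define c where "c = exp (\<i> * of_real (- (\<mu> + \<Lambda>) * (u - r)))"
        have phase: "exp (\<i> * of_real (\<Lambda> * t)) * exp (\<i> * of_real (- (\<mu> + \<Lambda>) * (u + (t - r))))
            = c * exp (\<i> * of_real (- \<mu> * t))" for t
          unfolding c_def exp_add[symmetric] by (simp add: algebra_simps)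
        have inn: "cinner x (U u (p (U (t - r) \<xi>))) = cinner (p (U (- u) x)) (U t (U (- r) \<xi>))" for t
          using U_adjoint[of "- u" x "p (U (t - r) \<xi>)"] by (simp add: p_self_adjoint U_add[symmetric])
        have arg: "complex_of_real (u + (t - r)) = of_real t + of_real (u - r)" for t
          by simp
        have "H t u = c * ((exp (\<i> * of_real (- \<mu> * t)) * (q (of_real t) * g (of_real t + of_real (u - r))))
            * cinner (p (U (- u) x)) (U t (U (- r) \<xi>)))" for t
          using phase[of t] unfolding H_def a_def f_def inn arg by (simp only: mult_ac)
        then have "(LINT t|lborel. H t u) = c * (LINT t|lborel. (exp (\<i> * of_real (- \<mu> * t))
            * (q (of_real t) * g (of_real t + of_real (u - r)))) * cinner (p (U (- u) x)) (U t (U (- r) \<xi>)))"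
          by (simp only: integral_mult_right_zero)
        also have "\<dots> = c * 0"
          by (simp only: \<mu>[unfolded energy_above_def, rule_format, OF upper_test_mult_shift[OF q g]])
        finally show ?thesis
          by simp
      qed
      then show ?thesis
        by simp
    qed
    finally show "(LINT t|lborel. a t * cinner v (conjugate (r - t) \<xi>)) = 0" .
  qed
  then have "v = 0"
    using triv by simp
  then show "(LINT t|lborel. (exp (\<i> * of_real (- (\<mu> + \<Lambda>) * t)) * g (of_real t)) * cinner x (U t y)) = 0"
    using v[of y] by (simp add: f_def cinner.zero_left)
qed

lemma conjugate_constant:
  assumes UNIV: "\<And>\<Lambda> q. \<Lambda> > 0 \<Longrightarrow> upper_test q \<Longrightarrow> raising_kernel \<Lambda> q = UNIV"
  shows "conjugate s \<xi> = p \<xi>"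
proof -
  \<comment> \<open>The sign of time matches \<open>conjugate (r - t)\<close> at
    \<open>r = 0\<close>.\<close>
  define k where "k \<eta> \<xi> t = cinner \<eta> (conjugate (- t) \<xi>)" for \<eta> \<xi> t
  have k_cont: "continuous_on UNIV (k \<eta> \<xi>)" for \<eta> \<xi>
    unfolding k_def by (intro cinner.continuous_on continuous_on_conjugate continuous_intros)
  have k_bnd: "norm (k \<eta> \<xi> t) \<le> norm \<eta> * (onorm p * norm \<xi>)" for \<eta> \<xi> t
    using norm_cinner_le[of \<eta> "conjugate (- t) \<xi>"] mult_left_mono[OF norm_conjugate_le[of "- t" \<xi>], of "norm \<eta>"]
    by (simp add: k_def)
  have k_int: "integrable lborel (\<lambda>t. q (of_real t) * k \<eta> \<xi> t)" if "upper_test q" for q \<eta> \<xi>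
    by (rule upper_test_integrable[OF that k_cont k_bnd])
  have lim0: "(\<lambda>n. 1 / real (Suc n)) \<longlonglongrightarrow> 0"
    using LIMSEQ_inverse_real_of_nat by (simp only: inverse_eq_divide)
  have kq: "(LINT t|lborel. q (of_real t) * k \<eta> \<xi> t) = 0" if q: "upper_test q" for q \<eta> \<xi>
  proof -
    have zero: "(LINT t|lborel. (q (of_real t) * k \<eta> \<xi> t) * exp (\<i> * of_real (0 + 1 / real (Suc n) * t))) = 0" for n
    proof -
      have "\<eta> \<in> raising_kernel (1 / real (Suc n)) q"
        using UNIV[OF _ q, of "1 / real (Suc n)"] by simp
      then have "(LINT t|lborel. (exp (\<i> * of_real (1 / real (Suc n) * t)) * q (of_real t))
          * cinner \<eta> (conjugate (0 - t) \<xi>)) = 0"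
        unfolding raising_kernel_def by blast
      then show ?thesis
        unfolding k_def by (simp only: add_0 diff_0 mult_ac)
    qed
    \<comment> \<open>Here the product of \<open>q\<close> and \<open>k\<close> is the integrable
      kernel, and the phase is the bounded continuous function evaluated near 0.\<close>
    have "(\<lambda>n. LINT t|lborel. (q (of_real t) * k \<eta> \<xi> t) * exp (\<i> * of_real (0 + 1 / real (Suc n) * t)))
        \<longlonglongrightarrow> (LINT t|lborel. q (of_real t) * k \<eta> \<xi> t) * exp (\<i> * of_real 0)"
      by (rule approximate_identity[OF k_int[OF q] _ _ lim0, where K=1]) (auto intro!: continuous_intros)
    then have "0 = (LINT t|lborel. q (of_real t) * k \<eta> \<xi> t) * exp (\<i> * of_real 0)"
      unfolding zero by (rule LIMSEQ_unique[OF tendsto_const])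
    then show ?thesis
      by simp
  qed
  have k_cnj: "cnj (k \<eta> \<xi> t) = k \<xi> \<eta> t" for \<eta> \<xi> t
    unfolding k_def by (metis cinner_commute conjugate_self_adjoint)
  have kq': "(LINT t|lborel. cnj (q (of_real t)) * k \<eta> \<xi> t) = 0" if q: "upper_test q" for q \<eta> \<xi>
  proof -
    have "cnj (q (of_real t)) * k \<eta> \<xi> t = cnj (q (of_real t) * k \<xi> \<eta> t)" for t
      by (simp add: k_cnj)
    then show ?thesis
      by (simp only: Bochner_Integration.integral_cnj kq[OF q] complex_cnj_zero)
  qed
  have const: "k \<eta> \<xi> x * pi = (LINT t|lborel. of_real (1 / (1 + t\<^sup>2)) * k \<eta> \<xi> t)" for \<eta> \<xi> x
  proof -
    have poisson: "(LINT t|lborel. of_real (1 / (1 + t\<^sup>2)) * k \<eta> \<xi> (x + b * t))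
        = (LINT t|lborel. of_real (1 / (1 + t\<^sup>2)) * k \<eta> \<xi> t)" if b: "b > 0" for b
    proof -
      \<comment> \<open>The poles x - i b and - i lie below the axis. After multiplication by
        \<open>c\<close>, the imaginary part on the real line is the Poisson kernel of i minus that
        of x + i b.\<close>
      define q where "q z = 1 / ((z + Complex (- x) b) * (z + \<i>))" for z
      have q: "upper_test q"
        unfolding q_def by (rule upper_test_Cauchy) (use b in auto)
      define c where "c = \<i> - Complex (- x) b"
      have ne: "complex_of_real t + Complex (- x) b \<noteq> 0" "complex_of_real t + \<i> \<noteq> 0" for t
        using b by (auto simp: complex_eq_iff)
      have cq: "c * q (of_real t) = 1 / (of_real t + Complex (- x) b) - 1 / (of_real t + \<i>)" for t
        using ne[of t] by (simp add: c_def q_def field_simps)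
      have ker: "of_real (1 / (1 + t\<^sup>2) - b / ((t - x)\<^sup>2 + b\<^sup>2))
          = (c * q (of_real t) - cnj (c * q (of_real t))) / (2 * \<i>)" for t
      proof -
        have "c * q (of_real t) - cnj (c * q (of_real t)) = of_real (2 * Im (c * q (of_real t))) * \<i>"
          by (rule complex_diff_cnj)
        moreover have "Im (c * q (of_real t)) = 1 / (1 + t\<^sup>2) - b / ((t - x)\<^sup>2 + b\<^sup>2)"
          unfolding cq by (simp add: Im_divide add.commute)
        ultimately have "c * q (of_real t) - cnj (c * q (of_real t))
            = of_real (2 * (1 / (1 + t\<^sup>2) - b / ((t - x)\<^sup>2 + b\<^sup>2))) * \<i>"
          by (simp only:)
        moreover have "complex_of_real r = of_real (2 * r) * \<i> / (2 * \<i>)" for r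
          by (simp add: complex_eq_iff)
        ultimately show ?thesis
          by metis
      qed
      have int1: "integrable lborel (\<lambda>t. of_real (1 / (1 + t\<^sup>2)) * k \<eta> \<xi> t)"
        by (rule integrable_mult_bounded_continuous[OF _ k_cont k_bnd])
          (use integrable_Cauchy_kernel in \<open>simp only: complex_of_real_integrable_eq\<close>)
      have "(LINT t|lborel. of_real (1 / (1 + t\<^sup>2) - b / ((t - x)\<^sup>2 + b\<^sup>2)) * k \<eta> \<xi> t)
          = (LINT t|lborel. c / (2 * \<i>) * (q (of_real t) * k \<eta> \<xi> t)
              - cnj c / (2 * \<i>) * (cnj (q (of_real t)) * k \<eta> \<xi> t))"
        unfolding ker by (rule Bochner_Integration.integral_cong) (simp_all add: field_simps)
      also have "\<dots> = 0"
      proof -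
        have "integrable lborel (\<lambda>t. cnj (q (of_real t) * k \<xi> \<eta> t))"
          using k_int[OF q] by (simp only: complex_integrable_cnj)
        then have "integrable lborel (\<lambda>t. cnj (q (of_real t)) * k \<eta> \<xi> t)"
          by (simp add: k_cnj)
        then show ?thesis
          using k_int[OF q] by (simp add: kq[OF q] kq'[OF q])
      qed
      finally have eq: "(LINT t|lborel. of_real (1 / (1 + t\<^sup>2)) * k \<eta> \<xi> t
          - of_real (b / ((t - x)\<^sup>2 + b\<^sup>2)) * k \<eta> \<xi> t) = 0"
        by (simp only: of_real_diff left_diff_distrib)
      have resc: "b * (b / ((x + b * t - x)\<^sup>2 + b\<^sup>2)) = 1 / (1 + t\<^sup>2)" for t
      proof -
        have "(x + b * t - x)\<^sup>2 + b\<^sup>2 = b\<^sup>2 * (1 + t\<^sup>2)"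
          by (simp add: power_mult_distrib distrib_left)
        then show ?thesis
          using b by (simp add: power2_eq_square)
      qed
      have "integrable lborel (\<lambda>t. of_real (b / ((t - x)\<^sup>2 + b\<^sup>2)) * k \<eta> \<xi> t)"
      proof (rule integrable_mult_bounded_continuous[OF _ k_cont k_bnd])
        have "integrable lborel (\<lambda>t. b / ((t - x)\<^sup>2 + b\<^sup>2))"
        proof (subst lborel_integrable_real_affine_iff[symmetric, of b _ x])
          have "b / ((x + b * t - x)\<^sup>2 + b\<^sup>2) = 1 / b * (1 / (1 + t\<^sup>2))" for t
            unfolding resc[of t, symmetric] using b by simp
          then show "integrable lborel (\<lambda>t. b / ((x + b * t - x)\<^sup>2 + b\<^sup>2))"
            using integrable_mult_right[OF integrable_Cauchy_kernel, of "1 / b"] by presburger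
        qed (use b in simp)
        then show "integrable lborel (\<lambda>t. complex_of_real (b / ((t - x)\<^sup>2 + b\<^sup>2)))"
          by (simp only: complex_of_real_integrable_eq)
      qed
      then have "(LINT t|lborel. of_real (1 / (1 + t\<^sup>2)) * k \<eta> \<xi> t)
          = (LINT t|lborel. of_real (b / ((t - x)\<^sup>2 + b\<^sup>2)) * k \<eta> \<xi> t)"
        using eq int1 by (simp only: Bochner_Integration.integral_diff eq_iff_diff_eq_0[symmetric])
      also have "\<dots> = b *\<^sub>R (LINT t|lborel. of_real (b / ((x + b * t - x)\<^sup>2 + b\<^sup>2)) * k \<eta> \<xi> (x + b * t))"
        using b by (subst lborel_integral_real_affine[of b _ x]) auto
      also have "\<dots> = (LINT t|lborel. of_real (b * (b / ((x + b * t - x)\<^sup>2 + b\<^sup>2))) * k \<eta> \<xi> (x + b * t))"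
        unfolding of_real_mult mult.assoc integral_mult_right_zero scaleR_conv_of_real by simp
      finally show ?thesis
        unfolding resc by simp
    qed
    have int_c: "integrable lborel (\<lambda>t. complex_of_real (1 / (1 + t\<^sup>2)))"
      using integrable_Cauchy_kernel by (simp only: complex_of_real_integrable_eq)
    have pi: "(LINT t|lborel. complex_of_real (1 / (1 + t\<^sup>2))) = of_real pi"
      using LBINT_inverse_1_plus_square
      by (simp only: integral_complex_of_real)
        (simp add: interval_lebesgue_integral_def set_lebesgue_integral_def einterval_eq inverse_eq_divide)
    \<comment> \<open>As b tends to 0 the Poisson kernels concentrate at \<open>x\<close>, while by
      \<open>poisson\<close> the sequence is constant.\<close>
    have "(\<lambda>n. LINT t|lborel. of_real (1 / (1 + t\<^sup>2)) * k \<eta> \<xi> (x + 1 / real (Suc n) * t))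
        \<longlonglongrightarrow> (LINT t|lborel. complex_of_real (1 / (1 + t\<^sup>2))) * k \<eta> \<xi> x"
      by (rule approximate_identity[OF int_c k_cont k_bnd lim0])
    then have "(\<lambda>n. LINT t|lborel. of_real (1 / (1 + t\<^sup>2)) * k \<eta> \<xi> t)
        \<longlonglongrightarrow> of_real pi * k \<eta> \<xi> x"
      by (simp only: poisson pi zero_less_divide_1_iff of_nat_0_less_iff zero_less_Suc)
    then show ?thesis
      by (metis LIMSEQ_unique tendsto_const mult.commute)
  qed
  have "k \<eta> \<xi> (- s) * pi = k \<eta> \<xi> 0 * pi" for \<eta>
    by (simp only: const)
  then have "k \<eta> \<xi> (- s) = k \<eta> \<xi> 0" for \<eta>
    by simp
  then have "cinner \<eta> (conjugate s \<xi> - p \<xi>) = 0" for \<eta>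
    by (simp add: k_def cinner.diff_right conjugate_def U_0)
  then have "cinner (conjugate s \<xi> - p \<xi>) (conjugate s \<xi> - p \<xi>) = 0" .
  then show ?thesis
    by (simp add: cinner_self)
qed

end

section \<open>Irreducibility of the restriction\<close>

lemma unitary_representationD:
  fixes \<pi> :: "'g \<Rightarrow> 'h::chilbert_space \<Rightarrow>\<^sub>L 'h"
  assumes "unitary_representation G T \<pi>" and x: "x \<in> carrier G"
  shows "blinfun_apply (\<pi> x) (a *\<^sub>C v) = a *\<^sub>C blinfun_apply (\<pi> x) v"
    and "cinner (blinfun_apply (\<pi> x) v) (blinfun_apply (\<pi> x) w) = cinner v w"
    and "y \<in> carrier G \<Longrightarrow> blinfun_apply (\<pi> (x \<otimes>\<^bsub>G\<^esub> y)) v = blinfun_apply (\<pi> x) (blinfun_apply (\<pi> y) v)"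
proof -
  have hom: "\<pi> \<in> hom G unitary_group"
    using assms(1) by (simp add: unitary_representation_def)
  have "\<pi> x \<in> carrier unitary_group"
    using hom x by (rule hom_in_carrier)
  then show "blinfun_apply (\<pi> x) (a *\<^sub>C v) = a *\<^sub>C blinfun_apply (\<pi> x) v"
    and "cinner (blinfun_apply (\<pi> x) v) (blinfun_apply (\<pi> x) w) = cinner v w"
    by (auto simp: unitary_group_def Vector_Spaces.linear_iff)
  show "blinfun_apply (\<pi> (x \<otimes>\<^bsub>G\<^esub> y)) v = blinfun_apply (\<pi> x) (blinfun_apply (\<pi> y) v)"
    if "y \<in> carrier G"
    using hom_mult[OF hom x that] by (simp add: unitary_group_def)
qed

text \<open>Multiplicativity makes the image of the unit idempotent, so it kills \<open>?w\<close>;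
  being isometric, it forces \<open>?w\<close> to be 0.\<close>

lemma unitary_representation_one:
  fixes \<pi> :: "'g \<Rightarrow> 'h::chilbert_space \<Rightarrow>\<^sub>L 'h"
  assumes \<pi>: "unitary_representation G T \<pi>" and "group G"
  shows "blinfun_apply (\<pi> \<one>\<^bsub>G\<^esub>) v = v"
proof -
  interpret group G by fact
  let ?w = "blinfun_apply (\<pi> \<one>\<^bsub>G\<^esub>) v - v"
  have "blinfun_apply (\<pi> \<one>\<^bsub>G\<^esub>) ?w = 0"
    using unitary_representationD(3)[OF \<pi>, of "\<one>\<^bsub>G\<^esub>" "\<one>\<^bsub>G\<^esub>" v] by (simp add: blinfun.diff_right)
  then have "cinner ?w ?w = 0"
    using unitary_representationD(2)[OF \<pi>, of "\<one>\<^bsub>G\<^esub>" ?w ?w] by (simp add: cinner.zero_left)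
  then show ?thesis
    by (simp add: cinner_self)
qed

lemma unitary_representation_inv:
  fixes \<pi> :: "'g \<Rightarrow> 'h::chilbert_space \<Rightarrow>\<^sub>L 'h"
  assumes \<pi>: "unitary_representation G T \<pi>" and G: "group G" and x: "x \<in> carrier G"
  shows "cinner (blinfun_apply (\<pi> x) v) w = cinner v (blinfun_apply (\<pi> (inv\<^bsub>G\<^esub> x)) w)"
proof -
  interpret group G by fact
  have "blinfun_apply (\<pi> x) (blinfun_apply (\<pi> (inv\<^bsub>G\<^esub> x)) w) = w"
    using unitary_representationD(3)[OF \<pi> x, of "inv\<^bsub>G\<^esub> x" w] x
    by (simp add: unitary_representation_one[OF \<pi> G])
  then show ?thesis
    using unitary_representationD(2)[OF \<pi> x, of v "blinfun_apply (\<pi> (inv\<^bsub>G\<^esub> x)) w"] by simp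
qed

lemma unitary_representation_restrict:
  assumes G: "topological_group G T" and act: "continuous_real_action G T \<alpha>"
    and \<pi>: "unitary_representation (semidirect_real G \<alpha>) (semidirect_real_topology T) \<pi>"
  shows "unitary_representation G T (\<lambda>g. \<pi> (g, 0))"
proof -
  interpret topological_group G T by fact
  note act_simps = continuous_real_action_simps[OF is_group act]
  have hom: "\<pi> \<in> hom (semidirect_real G \<alpha>) unitary_group"
    and cont: "continuous_map (semidirect_real_topology T)
      (subtopology strong_operator_topology (carrier unitary_group)) \<pi>"
    using \<pi> by (simp_all add: unitary_representation_def)
  have "(\<lambda>g. \<pi> (g, 0)) \<in> hom G unitary_group"
  proof (rule homI)
    show "\<pi> (g, 0) \<in> carrier unitary_group" if "g \<in> carrier G" for g
      using hom_in_carrier[OF hom] that by (simp add: semidirect_real_def)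
    show "\<pi> (g \<otimes>\<^bsub>G\<^esub> h, 0) = \<pi> (g, 0) \<otimes>\<^bsub>unitary_group\<^esub> \<pi> (h, 0)"
      if "g \<in> carrier G" "h \<in> carrier G" for g h
      using hom_mult[OF hom, of "(g, 0)" "(h, 0)"] that by (simp add: semidirect_real_def act_simps)
  qed
  moreover have "continuous_map T (semidirect_real_topology T) (\<lambda>g. (g, 0))"
    by (simp add: continuous_map_paired continuous_map_id[unfolded id_def])
  from continuous_map_compose[OF this cont]
  have "continuous_map T (subtopology strong_operator_topology (carrier unitary_group)) (\<lambda>g. \<pi> (g, 0))"
    by (simp add: o_def)
  ultimately show ?thesis
    by (simp add: unitary_representation_def)
qed

lemma positive_energy_flow:
  assumes G: "topological_group G T" and act: "continuous_real_action G T \<alpha>"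
    and pos: "positive_energy_representation G T \<alpha> \<pi>"
  shows "positive_unitary_flow (\<lambda>t. blinfun_apply (\<pi> (\<one>\<^bsub>G\<^esub>, t)))"
proof -
  interpret topological_group G T by fact
  let ?S = "semidirect_real G \<alpha>" and ?U = "\<lambda>t. blinfun_apply (\<pi> (\<one>\<^bsub>G\<^esub>, t))"
  note act_simps = continuous_real_action_simps[OF is_group act]
  have S: "group ?S"
    by (rule group_semidirect_real(1)[OF is_group act])
  have rep: "unitary_representation ?S (semidirect_real_topology T) \<pi>"
    and spec: "operator_spectrum (generator_domain (\<lambda>t. \<pi> (\<one>\<^bsub>G\<^esub>, t))) (generator (\<lambda>t. \<pi> (\<one>\<^bsub>G\<^esub>, t))) \<subseteq> \<real>\<^sub>\<ge>\<^sub>0"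
    using pos by (simp_all add: positive_energy_representation_def Let_def)
  have mem: "(\<one>\<^bsub>G\<^esub>, t) \<in> carrier ?S" for t
    by (simp add: semidirect_real_def)
  have flow: "unitary_flow ?U"
  proof
    show "?U 0 x = x" for x
      using unitary_representation_one[OF rep S] by (simp add: semidirect_real_def)
    have "(\<one>\<^bsub>G\<^esub>, s) \<otimes>\<^bsub>?S\<^esub> (\<one>\<^bsub>G\<^esub>, t) = (\<one>\<^bsub>G\<^esub>, s + t)" for s t
      by (simp add: semidirect_real_def act_simps)
    then show "?U (s + t) x = ?U s (?U t x)" for s t x
      using unitary_representationD(3)[OF rep mem mem] by metis
    show "?U t (x + y) = ?U t x + ?U t y" for t x y
      by (rule blinfun.add_right)
    show "?U t (a *\<^sub>C x) = a *\<^sub>C ?U t x" for t a x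
      by (rule unitary_representationD(1)[OF rep mem])
    show "cinner (?U t x) (?U t y) = cinner x y" for t x y
      by (rule unitary_representationD(2)[OF rep mem])
    show "continuous_on UNIV (\<lambda>t. ?U t x)" for x
    proof -
      have "continuous_map (semidirect_real_topology T) strong_operator_topology \<pi>"
        using rep by (simp add: unitary_representation_def continuous_map_in_subtopology)
      moreover have "continuous_map euclideanreal (semidirect_real_topology T) (\<lambda>t. (\<one>\<^bsub>G\<^esub>, t))"
        by (simp add: continuous_map_paired continuous_map_id[unfolded id_def] topspace_eq_carrier)
      ultimately have "continuous_map euclideanreal strong_operator_topology (\<lambda>t. \<pi> (\<one>\<^bsub>G\<^esub>, t))"
        using continuous_map_compose[of euclideanreal _ "\<lambda>t. (\<one>\<^bsub>G\<^esub>, t)" _ \<pi>] by (simp add: o_def)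
      then show ?thesis
        by (simp add: continuous_on_strong_operator_topo_iff_coordinatewise)
    qed
  qed
  show ?thesis
  proof (rule positive_unitary_flow.intro[OF flow], unfold_locales)
    fix c :: real assume "c > 0"
    then have "- complex_of_real c \<notin> \<real>\<^sub>\<ge>\<^sub>0"
      by (simp add: complex_nonneg_Reals_iff)
    then show "- complex_of_real c \<in> resolvent_set (unitary_flow.dom ?U) (unitary_flow.gen ?U)"
      using spec
      by (auto simp: operator_spectrum_def unitary_flow.dom_def[OF flow] unitary_flow.gen_def[OF flow, abs_def]
          generator_domain_def generator_def[abs_def])
  qed
qed

theorem theorem1p5:
  fixes G :: "('g, 'm) monoid_scheme" and T :: "'g topology"
    and \<alpha> :: "real \<Rightarrow> 'g \<Rightarrow> 'g"
    and \<pi> :: "'g \<times> real \<Rightarrow> 'h::chilbert_space \<Rightarrow>\<^sub>L 'h"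
  assumes "topological_group G T"
    and "continuous_real_action G T \<alpha>"
    and "positive_energy_representation G T \<alpha> \<pi>"
    and "irreducible_unitary_representation (semidirect_real G \<alpha>) (semidirect_real_topology T) \<pi>"
  shows "irreducible_unitary_representation G T (\<lambda>g. \<pi> (g, 0))"
proof -
  let ?S = "semidirect_real G \<alpha>"
  define U where "U t = blinfun_apply (\<pi> (\<one>\<^bsub>G\<^esub>, t))" for t
  define V where "V g = blinfun_apply (\<pi> (g, 0))" for g
  interpret topological_group G T by fact
  note act_simps = continuous_real_action_simps[OF is_group assms(2)]
  have S: "group ?S"
    by (rule group_semidirect_real(1)[OF is_group assms(2)])
  have rep: "unitary_representation ?S (semidirect_real_topology T) \<pi>"
    and nontrivial: "(UNIV :: 'h set) \<noteq> {0}"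
    and irr: "\<And>W. closed W \<Longrightarrow> complex_vector.subspace W \<Longrightarrow>
      (\<And>x. x \<in> carrier ?S \<Longrightarrow> blinfun_apply (\<pi> x) ` W \<subseteq> W) \<Longrightarrow> W = {0} \<or> W = UNIV"
    using assms(4) by (auto simp: irreducible_unitary_representation_def)
  interpret positive_unitary_flow U
    using positive_energy_flow[OF assms(1-3)] unfolding U_def[abs_def] .
  have mem: "(g, t) \<in> carrier ?S" if "g \<in> carrier G" for g t
    using that by (simp add: semidirect_real_def)
  have mult: "(g, s) \<otimes>\<^bsub>?S\<^esub> (h, t) = (g \<otimes>\<^bsub>G\<^esub> \<alpha> s h, s + t)" for g h s t
    by (simp add: semidirect_real_def)
  \<comment> \<open>Factorisation of (g, t) as (g, 0) times (1, t). The opposite order, used next,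
    produces \<alpha> t g in the first component; comparing the two gives the covariance relation
    \<open>UV\<close>.\<close>
  have split: "blinfun_apply (\<pi> (g, t)) x = V g (U t x)" if "g \<in> carrier G" for g t x
    using unitary_representationD(3)[OF rep mem mem, of g "\<one>\<^bsub>G\<^esub>" 0 t x] that
    by (simp add: mult act_simps V_def U_def)
  have split': "blinfun_apply (\<pi> (\<alpha> t g, t)) x = U t (V g x)" if "g \<in> carrier G" for g t x
    using unitary_representationD(3)[OF rep mem mem, of "\<one>\<^bsub>G\<^esub>" g t 0 x] that
    by (simp add: mult act_simps V_def U_def)
  have UV: "U t (V g x) = V (\<alpha> t g) (U t x)" if "g \<in> carrier G" for g t x
    using split[of "\<alpha> t g" t x] split'[OF that, of t x] that by (simp add: act_simps)
  have V_adj: "cinner (V g x) y = cinner x (V (inv\<^bsub>G\<^esub> g) y)" if "g \<in> carrier G" for g x y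
    using unitary_representation_inv[OF rep S mem[OF that], of 0 x y] that
    by (simp add: V_def group_semidirect_real(2)[OF is_group assms(2)] act_simps)
  have irr': "W = {0} \<or> W = UNIV"
    if "closed W" "complex_vector.subspace W" "\<And>t. U t ` W \<subseteq> W" "\<And>g. g \<in> carrier G \<Longrightarrow> V g ` W \<subseteq> W" for W
  proof (rule irr[OF that(1,2)])
    fix x assume "x \<in> carrier ?S"
    then obtain g t where x: "x = (g, t)" "g \<in> carrier G"
      by (auto simp: semidirect_real_def)
    show "blinfun_apply (\<pi> x) ` W \<subseteq> W"
      using that(3)[of t] that(4)[OF x(2)] split[OF x(2), of t] by (auto simp: x(1))
  qed
  have "W = {0} \<or> W = UNIV"
    if W: "closed W" "complex_vector.subspace W" and inv: "\<And>g. g \<in> carrier G \<Longrightarrow> V g ` W \<subseteq> W" for W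
  proof -
    define p where "p = orthogonal_projection W"
    interpret flow_with_operator U p
      by (intro flow_with_operator.intro flow_with_operator_axioms.intro unitary_flow_axioms)
        (simp_all add: p_def bounded_linear_orthogonal_projection[OF W] cinner_orthogonal_projection[OF W])
    have Vp: "p (V g x) = V g (p x)" if g: "g \<in> carrier G" for g x
      unfolding p_def
    proof (rule orthogonal_projection_commute[OF W])
      show "bounded_linear (V g)"
        unfolding V_def by (rule blinfun.bounded_linear_right)
      show "V (inv\<^bsub>G\<^esub> g) ` W \<subseteq> W"
        using g by (intro inv) simp
      show "cinner x (V g y) = cinner (V (inv\<^bsub>G\<^esub> g) x) y" for x y
        using V_adj[of "inv\<^bsub>G\<^esub> g" x y] g by simp
    qed (rule inv[OF g])
    \<comment> \<open>The translated projection belongs to the translate of \<open>W\<close> by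
      \<open>U t\<close>, which is again invariant under G because the flow normalises the image of
      G.\<close>
    have V_conj: "V g (conjugate t x) = conjugate t (V g x)" if g: "g \<in> carrier G" for g t x
    proof -
      have h: "\<alpha> (- t) g \<in> carrier G" "\<alpha> t (\<alpha> (- t) g) = g"
        using g act_simps(3)[OF g, of t "- t"] by (simp_all add: act_simps)
      have "conjugate t (V g x) = U t (V (\<alpha> (- t) g) (p (U (- t) x)))"
        by (simp add: conjugate_def UV[OF g] Vp[OF h(1)])
      then show ?thesis
        by (simp add: UV[OF h(1)] h(2)) (simp add: conjugate_def)
    qed
    \<comment> \<open>Although \<open>W\<close> is invariant only under G, the raising kernel is
      also invariant under the flow, so irreducibility of the full representation applies to
      it.\<close>
    have dichotomy: "raising_kernel \<Lambda> q = {0} \<or> raising_kernel \<Lambda> q = UNIV" if q: "upper_test q" for \<Lambda> q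
    proof (rule irr'[OF raising_kernel_closed_subspace[OF q] raising_kernel_U])
      show "V g ` raising_kernel \<Lambda> q \<subseteq> raising_kernel \<Lambda> q" if "g \<in> carrier G" for g
        using that by (intro raising_kernel_invariant[of "V g" "V (inv\<^bsub>G\<^esub> g)"] V_adj V_conj) simp_all
    qed
    have "raising_kernel \<Lambda> q = UNIV" if "\<Lambda> > 0" and q: "upper_test q" for \<Lambda> q
    proof (rule ccontr)
      assume "raising_kernel \<Lambda> q \<noteq> UNIV"
      then have zero: "raising_kernel \<Lambda> q = {0}"
        using dichotomy[OF q] by blast
      have "energy_above (real n * \<Lambda>)" for n
      proof (induction n)
        case 0
        show ?case
          by (simp add: energy_above_def upper_test_integral_flow)
      next
        case (Suc n)
        show ?case
          using energy_above_raise[OF Suc q zero] by (simp add: algebra_simps)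
      qed
      then have "x = 0" for x :: 'h
        by (rule energy_above_unbounded[OF that(1)])
      then show False
        using nontrivial by blast
    qed
    then have const: "conjugate t x = p x" for t x
      by (rule conjugate_constant)
    have "U t w \<in> W" if "w \<in> W" for t w
    proof -
      \<comment> \<open>Transported back by \<open>U (- t)\<close>, the vector is \<open>w\<close>,
        which the projection fixes; so the translated projection fixes \<open>U t w\<close>.\<close>
      have "U t w = conjugate t (U t w)"
        using orthogonal_projection_fixes[OF W that] by (simp add: conjugate_def U_inverse p_def[symmetric])
      then have "U t w = p (U t w)"
        by (simp only: const)
      then show ?thesis
        using orthogonal_projection_in[OF W] unfolding p_def by metis
    qed
    then show ?thesis
      by (intro irr'[OF W] inv) auto
  qed
  then show ?thesis
    using unitary_representation_restrict[OF assms(1,2) rep] nontrivial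
    by (simp add: irreducible_unitary_representation_def V_def)
qed

end
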